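(* Let $\underline E$ (on $\mathcal H_E\supseteq\mathcal H_C$) be a minimal contractive lifting of a row contraction $\underline C$ on $\mathcal H_C$, and let $\underline E'$ (on $\mathcal H_{E'}\supseteq\mathcal H_E$) be a minimal contractive lifting of $\underline E$. Put $$\mathcal H_{\tilde E}=\overline{\mathrm{span}}\{E'_\alpha x:\ x\in\mathcal H_C,\ \alpha\in\tilde\Lambda\},\qquad \underline{\tilde E}=\underline E'|_{\mathcal H_{\tilde E}}.$$ Let $\mathcal H_{\tilde A}=\mathcal H_{E'}\ominus\mathcal H_{\tilde E}$, $\underline{\tilde X}=P_{\mathcal H_{\tilde E}}\underline E'|_{\mathcal H_{\tilde A}}$, $\underline{\tilde A}=P_{\mathcal H_{\tilde A}}\underline E'|_{\mathcal H_{\tilde A}}$, so that $\underline E'=\begin{bmatrix}\underline{\tilde E}&\underline{\tilde X}\\0&\underline{\tilde A}\end{bmatrix}$; let $\gamma:\mathcal D_{\tilde A}\to\mathcal D_{*,\tilde E}$ be the contraction with $\underline{\tilde X}=D_{*,\tilde E}\gamma D_{\tilde A}$, and let $\sigma:\mathcal D_{E'}\to\mathcal D_{\tilde E}\oplus\mathcal D_\gamma$ be the unitary determined by $$\sigma D_{E'}=\begin{bmatrix}D_{\tilde E}&-\underline{\tilde E}^*\gamma D_{\tilde A}\\0&D_\gamma D_{\tilde A}\end{bmatrix}.$$ Then $\underline{\tilde E}$ is a minimal contractive lifting of $\underline C$, and $$M_{C,\tilde E}=M_{C,E}\,M_{E,E'}\,\big(I_\Gamma\otimes\sigma^{-1}|_{\mathcal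 D_{\tilde E}}\big).$$
   Context: Fix an integer $d\ge2$. $\Gamma=\mathbb C\oplus\mathbb C^d\oplus(\mathbb C^d)^{\otimes2}\oplus\cdots$ is the full Fock space over $\mathbb C^d$, with vacuum vector $e_0=1\oplus0\oplus\cdots$. $\{e_1,\dots,e_d\}$ is the standard basis of $\mathbb C^d$; $\tilde\Lambda=\bigcup_{n\ge0}\{1,\dots,d\}^n$ is the set of words (including the empty word), $e_\alpha=e_{\alpha_1}\otimes\cdots\otimes e_{\alpha_n}$ (and $e_0$ for the empty word), $S_\alpha=S_{\alpha_1}\cdots S_{\alpha_n}$ (and $I$ for the empty word). A row contraction on a Hilbert space $\mathcal H$ is a tuple $\underline S=(S_1,\dots,S_d)$ of bounded operators on $\mathcal H$ with $\sum_iS_iS_i^*\le I$; it is also regarded as the row operator $\underline S:\mathcal H^d\to\mathcal H$ (similarly for tuples of operators between different spaces). Restrictions and compressions of tuples are taken entrywise. Defect operators: $D_S=(I-\underline S^*\underline S)^{1/2}$ on $\mathcal H^d$ and $D_{*,S}=(I-\underline S\,\underline S^* )^{1/2}$ on $\mathcal H$; defect spaces $\mathcal D_S=\overline{\mathrm{ran}}\,D_S$, $\mathcal D_{*,S}=\overline{\mathrm{ran}}\,D_{*,S}$. For $h\in\mathcal H$, $(D_S)_jh=D_S(0,\dots,h,\dots,0)$ with $h$ in the $j$-th place. For a contraction $T:\mathcal X\to\mathcal Y$, $D_T=(I-T^*T)^{1/2}$ on $\mathcal X$ and $\mathcal D_T=\overline{\mathrm{ran}}\,D_T$. Block operators on $\mathcal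 H_{E'}^d$ refer to $\mathcal H_{E'}^d=\mathcal H_{\tilde E}^d\oplus\mathcal H_{\tilde A}^d$. A lifting of $\underline C$ (on $\mathcal H_C$) by $\underline A$ (on $\mathcal H_A$) is a tuple $\underline E$ on $\mathcal H_E=\mathcal H_C\oplus\mathcal H_A$ with $E_i=\begin{bmatrix}C_i&0\\ B_i&A_i\end{bmatrix}$, $i=1,\dots,d$; it is contractive if $\underline E$ is a row contraction, and a contractive lifting is minimal if $\mathcal H_E=\overline{\mathrm{span}}\{E_\alpha x:x\in\mathcal H_C,\alpha\in\tilde\Lambda\}$. The minimal isometric dilation $\underline V^S$ of a row contraction $\underline S$ on $\mathcal H_S$ acts on $\hat{\mathcal H}_S=\mathcal H_S\oplus(\Gamma\otimes\mathcal D_S)$ by $V_j^S(h\oplus\sum_\alpha e_\alpha\otimes d_\alpha)=S_jh\oplus\big(e_0\otimes(D_S)_jh+e_j\otimes\sum_\alpha e_\alpha\otimes d_\alpha\big)$. Characteristic function of a minimal contractive lifting $\underline E$ of $\underline C$: $\overline{\mathrm{span}}\{V^E_\alpha h:h\in\mathcal H_C\}$ is a reducing subspace of $\underline V^E$ on which $\underline V^E$ is a copy of $\underline V^C$. Let $\mathcal K$ be its orthogonal complement in $\hat{\mathcal H}_E$ and $\underline Y=\underline V^E|_{\mathcal K}$. There is a unitary $W:\hat{\mathcal H}_E\to\hat{\mathcal H}_C\oplus\mathcal K$ with $W|_{\mathcal H_C}=I$ and $WV_i^E=(V^C_i\oplus Y_i)W$ for all $i$. Then $M_{C,E}=P_{\Gamma\otimes\mathcal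 D_C}W|_{\Gamma\otimes\mathcal D_E}:\Gamma\otimes\mathcal D_E\to\Gamma\otimes\mathcal D_C$. The existence of the contraction $\gamma$ and of the unitary $\sigma$ used in the claim is a known fact (Sz.-Nagy--Foias), valid because $\underline E'$ is a row contraction. *)

theory Defs
  imports "HOL-Analysis.Analysis"
begin

section \<open>Complex Hilbert spaces\<close>

text \<open>The complex inner product \<open>cinner\<close> is conjugate linear in its first argument.
  Positive definiteness and the norm come from \<open>real_inner\<close>, since \<open>inner\<close> is the
  real part of \<open>cinner\<close>.\<close>

class chilbert_space = real_inner + complete_space +
  fixes scaleC :: "complex \<Rightarrow> 'a \<Rightarrow> 'a" (infixr "*\<^sub>C" 75)
    and cinner :: "'a \<Rightarrow> 'a \<Rightarrow> complex"
  assumes scaleC_add_right: "a *\<^sub>C (x + y) = a *\<^sub>C x + a *\<^sub>C y"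
    and scaleC_add_left: "(a + b) *\<^sub>C x = a *\<^sub>C x + b *\<^sub>C x"
    and scaleC_scaleC: "a *\<^sub>C (b *\<^sub>C x) = (a * b) *\<^sub>C x"
    and scaleC_one: "1 *\<^sub>C x = x"
    and scaleR_scaleC: "r *\<^sub>R x = complex_of_real r *\<^sub>C x"
    and cinner_commute: "cinner x y = cnj (cinner y x)"
    and cinner_add_left: "cinner (x + y) z = cinner x z + cinner y z"
    and cinner_scaleC_left: "cinner (a *\<^sub>C x) y = cnj a * cinner x y"
    and inner_eq_Re_cinner: "inner x y = Re (cinner x y)"

global_interpretation complex_vector: vector_space "scaleC :: complex \<Rightarrow> 'a \<Rightarrow> 'a::chilbert_space"
  defines csubspace = complex_vector.subspace
    and cspan = complex_vector.span
  by standard (simp_all add: scaleC_add_right scaleC_add_left scaleC_scaleC scaleC_one)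

instantiation complex :: chilbert_space
begin

definition scaleC_complex :: "complex \<Rightarrow> complex \<Rightarrow> complex"
  where "scaleC_complex a x = a * x"

definition cinner_complex :: "complex \<Rightarrow> complex \<Rightarrow> complex"
  where "cinner_complex x y = cnj x * y"

instance
  by standard (simp_all add: scaleC_complex_def cinner_complex_def algebra_simps
      scaleR_conv_of_real inner_complex_def)

end

instantiation prod :: (chilbert_space, chilbert_space) chilbert_space
begin

definition scaleC_prod :: "complex \<Rightarrow> 'a \<times> 'b \<Rightarrow> 'a \<times> 'b"
  where "scaleC_prod a x = (a *\<^sub>C fst x, a *\<^sub>C snd x)"

definition cinner_prod :: "'a \<times> 'b \<Rightarrow> 'a \<times> 'b \<Rightarrow> complex"
  where "cinner_prod x y = cinner (fst x) (fst y) + cinner (snd x) (snd y)"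

instance
proof
  fix x y z :: "'a \<times> 'b"
  show "cinner x y = cnj (cinner y x)"
    unfolding cinner_prod_def complex_cnj_add
    by (intro arg_cong2[where f = "(+)"] cinner_commute)
qed (simp_all add: scaleC_prod_def cinner_prod_def scaleC_add_right scaleC_add_left
      scaleC_scaleC scaleC_one scaleR_scaleC cinner_add_left cinner_scaleC_left
      inner_eq_Re_cinner inner_prod_def algebra_simps prod_eq_iff)

end

instantiation vec :: (chilbert_space, finite) chilbert_space
begin

definition scaleC_vec :: "complex \<Rightarrow> 'a ^ 'b \<Rightarrow> 'a ^ 'b"
  where "scaleC_vec a x = (\<chi> i. a *\<^sub>C (x $ i))"

definition cinner_vec :: "'a ^ 'b \<Rightarrow> 'a ^ 'b \<Rightarrow> complex"
  where "cinner_vec x y = (\<Sum>i\<in>UNIV. cinner (x $ i) (y $ i))"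

instance
proof
  fix x y z :: "'a ^ 'b"
  show "cinner x y = cnj (cinner y x)"
    unfolding cinner_vec_def cnj_sum
    by (intro sum.cong cinner_commute refl)
qed (simp_all add: scaleC_vec_def cinner_vec_def scaleC_add_right scaleC_add_left
      scaleC_scaleC scaleC_one scaleR_scaleC cinner_add_left cinner_scaleC_left
      inner_eq_Re_cinner inner_vec_def vec_eq_iff sum.distrib sum_distrib_left)

end

lemma cinner_scaleC_right: "cinner x (a *\<^sub>C y) = a * cinner x y"
  using cinner_commute[of x "a *\<^sub>C y"] cinner_commute[of x y] by (simp add: cinner_scaleC_left)

lemma norm_scaleC: "norm (a *\<^sub>C x) = cmod a * norm x"
proof -
  have "cinner (a *\<^sub>C x) (a *\<^sub>C x) = (cnj a * a) * cinner x x"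
    by (simp add: cinner_scaleC_left cinner_scaleC_right)
  also have "cnj a * a = complex_of_real ((cmod a)\<^sup>2)"
    using complex_norm_square[of a] by (simp add: mult.commute)
  finally have "inner (a *\<^sub>C x) (a *\<^sub>C x) = (cmod a)\<^sup>2 * inner x x"
    by (simp add: inner_eq_Re_cinner)
  then show ?thesis
    by (simp add: norm_eq_sqrt_inner real_sqrt_mult)
qed

lemma norm_cinner_le: "cmod (cinner x y) \<le> norm x * norm y"
proof (cases "cinner x y = 0")
  case False
  define u where "u = cnj (cinner x y) / of_real (cmod (cinner x y))"
  have u: "cmod u = 1"
    using False by (simp add: u_def norm_divide)
  have "cinner x (u *\<^sub>C y) = of_real (cmod (cinner x y))"
    using False
    by (simp add: u_def cinner_scaleC_right complex_norm_square[symmetric] field_simps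
        power2_eq_square)
  then have "cmod (cinner x y) = inner x (u *\<^sub>C y)"
    by (simp add: inner_eq_Re_cinner)
  also have "\<dots> \<le> norm x * norm (u *\<^sub>C y)"
    by (rule norm_cauchy_schwarz)
  finally show ?thesis
    by (simp add: norm_scaleC u)
qed simp


section \<open>Hilbert space valued \<open>\<ell>\<^sup>2\<close>\<close>

definition square_summable :: "('i \<Rightarrow> 'a::real_normed_vector) \<Rightarrow> bool"
  where "square_summable f \<longleftrightarrow> (\<lambda>i. (norm (f i))\<^sup>2) summable_on UNIV"

typedef (overloaded) ('i, 'a) ell2 = "{f :: 'i \<Rightarrow> 'a::chilbert_space. square_summable f}"
  morphisms ell2_nth Abs_ell2
  by (rule exI[of _ "\<lambda>_. 0"]) (simp add: square_summable_def)

setup_lifting type_definition_ell2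

lemma square_summable_ell2_nth: "square_summable (ell2_nth f)"
  using ell2_nth[of f] by simp

lemma square_summable_add:
  assumes "square_summable f" "square_summable g"
  shows "square_summable (\<lambda>i. f i + g i)"
proof -
  have "(\<lambda>i. 2 * (norm (f i))\<^sup>2 + 2 * (norm (g i))\<^sup>2) summable_on UNIV"
    using assms unfolding square_summable_def
    by (intro summable_on_add summable_on_cmult_right)
  moreover have "(norm (f i + g i))\<^sup>2 \<le> 2 * (norm (f i))\<^sup>2 + 2 * (norm (g i))\<^sup>2" for i
  proof -
    have "(norm (f i + g i))\<^sup>2 \<le> (norm (f i) + norm (g i))\<^sup>2"
      by (intro power_mono norm_triangle_ineq) simp
    also have "\<dots> \<le> 2 * (norm (f i))\<^sup>2 + 2 * (norm (g i))\<^sup>2"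
      using sum_squares_bound[of "norm (f i)" "norm (g i)"] by (simp add: power2_sum)
    finally show ?thesis .
  qed
  ultimately show ?thesis
    unfolding square_summable_def by (rule summable_on_comparison_test) simp_all
qed

lemma square_summable_bound:
  assumes "square_summable f" "\<And>i. norm (g i) \<le> c * norm (f i)"
  shows "square_summable g"
proof -
  have "(\<lambda>i. c\<^sup>2 * (norm (f i))\<^sup>2) summable_on UNIV"
    using assms(1) unfolding square_summable_def by (intro summable_on_cmult_right)
  moreover have "(norm (g i))\<^sup>2 \<le> c\<^sup>2 * (norm (f i))\<^sup>2" for i
    using power_mono[OF assms(2)[of i] norm_ge_zero, of 2] by (simp add: power_mult_distrib)
  ultimately show ?thesis
    unfolding square_summable_def by (rule summable_on_comparison_test) simp_all
qed

lemma square_summable_cinner: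
  assumes "square_summable f" "square_summable g"
  shows "(\<lambda>i. cinner (f i) (g i)) summable_on UNIV"
proof -
  have "(\<lambda>i. (norm (f i))\<^sup>2 + (norm (g i))\<^sup>2) summable_on UNIV"
    using assms unfolding square_summable_def by (intro summable_on_add)
  moreover have "norm (cinner (f i) (g i)) \<le> (norm (f i))\<^sup>2 + (norm (g i))\<^sup>2" for i
  proof -
    have "0 \<le> norm (f i) * norm (g i)" by simp
    then show ?thesis
      using norm_cinner_le[of "f i" "g i"] sum_squares_bound[of "norm (f i)" "norm (g i)"] by linarith
  qed
  ultimately have "(\<lambda>i. norm (cinner (f i) (g i))) summable_on UNIV"
    by (rule summable_on_comparison_test) simp_all
  then show ?thesis
    by (rule abs_summable_summable)
qed

instantiation ell2 :: (type, chilbert_space) real_inner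
begin

lift_definition zero_ell2 :: "('a, 'b) ell2" is "\<lambda>_. 0"
  by (simp add: square_summable_def)

lift_definition plus_ell2 :: "('a, 'b) ell2 \<Rightarrow> ('a, 'b) ell2 \<Rightarrow> ('a, 'b) ell2"
  is "\<lambda>f g i. f i + g i"
  by (rule square_summable_add)

lift_definition uminus_ell2 :: "('a, 'b) ell2 \<Rightarrow> ('a, 'b) ell2" is "\<lambda>f i. - f i"
  by (simp add: square_summable_def)

lift_definition minus_ell2 :: "('a, 'b) ell2 \<Rightarrow> ('a, 'b) ell2 \<Rightarrow> ('a, 'b) ell2"
  is "\<lambda>f g i. f i - g i"
proof -
  fix f g :: "'a \<Rightarrow> 'b"
  assume "square_summable f" "square_summable g"
  then show "square_summable (\<lambda>i. f i - g i)"
    using square_summable_add[of f "\<lambda>i. - g i"] by (simp add: square_summable_def)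
qed

lift_definition scaleR_ell2 :: "real \<Rightarrow> ('a, 'b) ell2 \<Rightarrow> ('a, 'b) ell2"
  is "\<lambda>r f i. r *\<^sub>R f i"
  by (erule square_summable_bound, rule eq_refl, rule norm_scaleR)

definition inner_ell2 :: "('a, 'b) ell2 \<Rightarrow> ('a, 'b) ell2 \<Rightarrow> real"
  where "inner_ell2 f g = (\<Sum>\<^sub>\<infinity>i. inner (ell2_nth f i) (ell2_nth g i))"

definition norm_ell2 :: "('a, 'b) ell2 \<Rightarrow> real"
  where "norm_ell2 f = sqrt (inner f f)"

definition sgn_ell2 :: "('a, 'b) ell2 \<Rightarrow> ('a, 'b) ell2"
  where "sgn_ell2 f = inverse (norm f) *\<^sub>R f"

definition dist_ell2 :: "('a, 'b) ell2 \<Rightarrow> ('a, 'b) ell2 \<Rightarrow> real"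
  where "dist_ell2 f g = norm (f - g)"

definition uniformity_ell2 :: "(('a, 'b) ell2 \<times> ('a, 'b) ell2) filter"
  where "uniformity_ell2 = (INF e\<in>{0<..}. principal {(x, y). dist x y < e})"

definition open_ell2 :: "('a, 'b) ell2 set \<Rightarrow> bool"
  where "open_ell2 U \<longleftrightarrow> (\<forall>x\<in>U. eventually (\<lambda>(x', y). x' = x \<longrightarrow> y \<in> U) uniformity)"

lemma inner_ell2_summable:
  "(\<lambda>i. inner (ell2_nth f i) (ell2_nth g i)) summable_on UNIV"
  unfolding inner_eq_Re_cinner
  by (intro summable_on_Re square_summable_cinner square_summable_ell2_nth)

instance
proof
  fix f g h :: "('a, 'b) ell2" and r s :: real
  show "f + g + h = f + (g + h)" by transfer (simp add: algebra_simps)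
  show "f + g = g + f" by transfer (simp add: algebra_simps)
  show "0 + f = f" by transfer simp
  show "- f + f = 0" by transfer simp
  show "f - g = f + - g" by transfer simp
  show "r *\<^sub>R (f + g) = r *\<^sub>R f + r *\<^sub>R g" by transfer (simp add: algebra_simps)
  show "(r + s) *\<^sub>R f = r *\<^sub>R f + s *\<^sub>R f" by transfer (simp add: algebra_simps)
  show "r *\<^sub>R s *\<^sub>R f = (r * s) *\<^sub>R f" by transfer simp
  show "1 *\<^sub>R f = f" by transfer simp
  show "dist f g = norm (f - g)" by (rule dist_ell2_def)
  show "sgn f = inverse (norm f) *\<^sub>R f" by (rule sgn_ell2_def)
  show "norm f = sqrt (inner f f)" by (rule norm_ell2_def)
  show "uniformity = (INF e\<in>{0<..}. principal {(x :: ('a, 'b) ell2, y). dist x y < e})"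
    by (rule uniformity_ell2_def)
  show "open U \<longleftrightarrow> (\<forall>x\<in>U. eventually (\<lambda>(x', y). x' = x \<longrightarrow> y \<in> U) uniformity)"
    for U :: "('a, 'b) ell2 set"
    by (rule open_ell2_def)
  show "inner f g = inner g f"
    by (simp add: inner_ell2_def inner_commute)
  show "inner (f + g) h = inner f h + inner g h"
    by (simp add: inner_ell2_def plus_ell2.rep_eq inner_add_left infsum_add inner_ell2_summable)
  show "inner (r *\<^sub>R f) g = r * inner f g"
    by (simp add: inner_ell2_def scaleR_ell2.rep_eq infsum_cmult_right')
  show "0 \<le> inner f f"
    by (simp add: inner_ell2_def infsum_nonneg)
  show "inner f f = 0 \<longleftrightarrow> f = 0"
  proof
    assume "inner f f = 0"
    then have "inner (ell2_nth f i) (ell2_nth f i) = 0" for i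
      using nonneg_infsum_le_0D[of "\<lambda>i. inner (ell2_nth f i) (ell2_nth f i)" UNIV i]
      by (simp add: inner_ell2_def inner_ell2_summable)
    then show "f = 0" by transfer auto
  qed (simp add: inner_ell2_def zero_ell2.rep_eq)
qed

end

lemma norm_ell2_power2: "(norm f)\<^sup>2 = (\<Sum>\<^sub>\<infinity>i. (norm (ell2_nth f i))\<^sup>2)"
  by (simp add: power2_norm_eq_inner inner_ell2_def)

lemma sum_ell2_le_norm:
  assumes "finite F"
  shows "(\<Sum>i\<in>F. (norm (ell2_nth f i))\<^sup>2) \<le> (norm f)\<^sup>2"
  unfolding norm_ell2_power2
  by (rule finite_sum_le_infsum)
    (use assms ell2_nth[of f] in \<open>auto simp: square_summable_def\<close>)

lemma norm_ell2_nth_le: "norm (ell2_nth f i) \<le> norm f"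
  using sum_ell2_le_norm[of "{i}" f] by (auto intro: power2_le_imp_le)

lemma ell2_bounded_sumsI:
  fixes f :: "'i \<Rightarrow> 'a::chilbert_space"
  assumes "\<And>F. finite F \<Longrightarrow> (\<Sum>i\<in>F. (norm (f i))\<^sup>2) \<le> B"
  shows "square_summable f" and "(norm (Abs_ell2 f))\<^sup>2 \<le> B"
proof -
  show *: "square_summable f"
    unfolding square_summable_def
    by (rule nonneg_bdd_above_summable_on) (use assms in \<open>auto intro!: bdd_aboveI\<close>)
  then have "(norm (Abs_ell2 f))\<^sup>2 = (\<Sum>\<^sub>\<infinity>i. (norm (f i))\<^sup>2)"
    by (simp add: norm_ell2_power2 Abs_ell2_inverse)
  also have "\<dots> \<le> B"
    by (rule infsum_le_finite_sums) (use * assms in \<open>auto simp: square_summable_def\<close>)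
  finally show "(norm (Abs_ell2 f))\<^sup>2 \<le> B" .
qed

instance ell2 :: (type, chilbert_space) complete_space
proof
  fix X :: "nat \<Rightarrow> ('a, 'b) ell2"
  assume X: "Cauchy X"
  have "Cauchy (\<lambda>n. ell2_nth (X n) i)" for i
  proof (rule metric_CauchyI)
    fix e :: real
    assume "e > 0"
    then obtain N where N: "\<forall>m\<ge>N. \<forall>n\<ge>N. dist (X m) (X n) < e"
      using metric_CauchyD[OF X] by blast
    have "dist (ell2_nth (X m) i) (ell2_nth (X n) i) < e" if "m \<ge> N" "n \<ge> N" for m n
      using norm_ell2_nth_le[of "X m - X n" i] N that
      by (force simp: dist_norm minus_ell2.rep_eq)
    then show "\<exists>M. \<forall>m\<ge>M. \<forall>n\<ge>M. dist (ell2_nth (X m) i) (ell2_nth (X n) i) < e"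
      by blast
  qed
  then have "\<exists>l. (\<lambda>n. ell2_nth (X n) i) \<longlonglongrightarrow> l" for i
    by (simp add: Cauchy_convergent_iff convergent_def)
  then obtain L where L: "\<And>i. (\<lambda>n. ell2_nth (X n) i) \<longlonglongrightarrow> L i"
    by metis
  have tail: "\<exists>N. \<forall>n\<ge>N. square_summable (\<lambda>i. ell2_nth (X n) i - L i) \<and>
      norm (Abs_ell2 (\<lambda>i. ell2_nth (X n) i - L i)) \<le> e" if "e > 0" for e :: real
  proof -
    obtain N where N: "\<And>m n. m \<ge> N \<Longrightarrow> n \<ge> N \<Longrightarrow> dist (X m) (X n) < e"
      using metric_CauchyD[OF X \<open>e > 0\<close>] by blast
    have fin: "(\<Sum>i\<in>F. (norm (ell2_nth (X n) i - L i))\<^sup>2) \<le> e\<^sup>2" if "n \<ge> N" "finite F" for n F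
    proof (rule tendsto_upperbound)
      show "(\<lambda>m. \<Sum>i\<in>F. (norm (ell2_nth (X n) i - ell2_nth (X m) i))\<^sup>2)
          \<longlonglongrightarrow> (\<Sum>i\<in>F. (norm (ell2_nth (X n) i - L i))\<^sup>2)"
        by (intro tendsto_intros L)
      show "\<forall>\<^sub>F m in sequentially. (\<Sum>i\<in>F. (norm (ell2_nth (X n) i - ell2_nth (X m) i))\<^sup>2) \<le> e\<^sup>2"
        using eventually_ge_at_top[of N]
      proof eventually_elim
        case (elim m)
        have "(\<Sum>i\<in>F. (norm (ell2_nth (X n) i - ell2_nth (X m) i))\<^sup>2) \<le> (norm (X n - X m))\<^sup>2"
          using sum_ell2_le_norm[OF \<open>finite F\<close>, of "X n - X m"] by (simp add: minus_ell2.rep_eq)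
        also have "\<dots> \<le> e\<^sup>2"
          using N[OF \<open>n \<ge> N\<close> elim] by (intro power_mono) (auto simp: dist_norm)
        finally show ?case .
      qed
    qed simp
    have "square_summable (\<lambda>i. ell2_nth (X n) i - L i) \<and>
      norm (Abs_ell2 (\<lambda>i. ell2_nth (X n) i - L i)) \<le> e" if "n \<ge> N" for n
      using ell2_bounded_sumsI[of "\<lambda>i. ell2_nth (X n) i - L i" "e\<^sup>2"] fin[OF that] \<open>e > 0\<close>
      by (auto intro: power2_le_imp_le)
    then show ?thesis by blast
  qed
  obtain n0 where n0: "square_summable (\<lambda>i. ell2_nth (X n0) i - L i)"
    using tail[of 1] by auto
  have "square_summable (\<lambda>i. ell2_nth (X n0 - Abs_ell2 (\<lambda>i. ell2_nth (X n0) i - L i)) i)"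
    using ell2_nth by auto
  then have LS: "square_summable L"
    using n0 by (simp add: minus_ell2.rep_eq Abs_ell2_inverse)
  have diff: "Abs_ell2 (\<lambda>i. ell2_nth (X n) i - L i) = X n - Abs_ell2 L" for n
    using LS by (simp add: minus_ell2_def Abs_ell2_inverse)
  have "X \<longlonglongrightarrow> Abs_ell2 L"
  proof (rule metric_LIMSEQ_I)
    fix e :: real
    assume "e > 0"
    then show "\<exists>N. \<forall>n\<ge>N. dist (X n) (Abs_ell2 L) < e"
      using tail[of "e / 2"] by (fastforce simp: diff dist_norm)
  qed
  then show "convergent X"
    by (rule convergentI)
qed

instantiation ell2 :: (type, chilbert_space) chilbert_space
begin

lift_definition scaleC_ell2 :: "complex \<Rightarrow> ('a, 'b) ell2 \<Rightarrow> ('a, 'b) ell2"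
  is "\<lambda>c f i. c *\<^sub>C f i"
  by (erule square_summable_bound, rule eq_refl, rule norm_scaleC)

definition cinner_ell2 :: "('a, 'b) ell2 \<Rightarrow> ('a, 'b) ell2 \<Rightarrow> complex"
  where "cinner_ell2 f g = (\<Sum>\<^sub>\<infinity>i. cinner (ell2_nth f i) (ell2_nth g i))"

lemma cinner_ell2_summable:
  "(\<lambda>i. cinner (ell2_nth f i) (ell2_nth g i)) summable_on UNIV"
  by (intro square_summable_cinner square_summable_ell2_nth)

instance
proof
  fix f g h :: "('a, 'b) ell2" and a b :: complex and r :: real
  show "a *\<^sub>C (f + g) = a *\<^sub>C f + a *\<^sub>C g" by transfer (simp add: scaleC_add_right)
  show "(a + b) *\<^sub>C f = a *\<^sub>C f + b *\<^sub>C f" by transfer (simp add: scaleC_add_left)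
  show "a *\<^sub>C b *\<^sub>C f = (a * b) *\<^sub>C f" by transfer (simp add: scaleC_scaleC)
  show "1 *\<^sub>C f = f" by transfer (simp add: scaleC_one)
  show "r *\<^sub>R f = complex_of_real r *\<^sub>C f" by transfer (simp add: scaleR_scaleC)
  show "cinner f g = cnj (cinner g f)"
    unfolding cinner_ell2_def infsum_cnj[symmetric] by (intro infsum_cong cinner_commute)
  show "cinner (f + g) h = cinner f h + cinner g h"
    by (simp add: cinner_ell2_def plus_ell2.rep_eq cinner_add_left infsum_add cinner_ell2_summable)
  show "cinner (a *\<^sub>C f) g = cnj a * cinner f g"
    by (simp add: cinner_ell2_def scaleC_ell2.rep_eq cinner_scaleC_left infsum_cmult_right')
  show "inner f g = Re (cinner f g)"
    by (simp add: inner_ell2_def cinner_ell2_def inner_eq_Re_cinner infsum_Re cinner_ell2_summable)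
qed

end


section \<open>Operators between closed subspaces\<close>

text \<open>Every Hilbert space below is a closed subspace of some type of class
  \<^class>\<open>chilbert_space\<close>.  An operator from \<open>H\<close> to \<open>K\<close> is represented by a function whose
  values outside \<open>H\<close> are irrelevant.\<close>

definition closed_csubspace :: "'a::chilbert_space set \<Rightarrow> bool"
  where "closed_csubspace M \<longleftrightarrow> csubspace M \<and> closed M"

definition ominus :: "'a::chilbert_space set \<Rightarrow> 'a set \<Rightarrow> 'a set" (infixl "\<ominus>" 65)
  where "H \<ominus> M = {x \<in> H. \<forall>m\<in>M. cinner m x = 0}"

definition cproj :: "'a::chilbert_space set \<Rightarrow> 'a \<Rightarrow> 'a"
  where "cproj M x = (THE p. p \<in> M \<and> (\<forall>m\<in>M. cinner m (x - p) = 0))"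

definition bounded_op ::
    "'a::chilbert_space set \<Rightarrow> 'b::chilbert_space set \<Rightarrow> ('a \<Rightarrow> 'b) \<Rightarrow> bool"
  where "bounded_op H K T \<longleftrightarrow>
    T ` H \<subseteq> K \<and>
    (\<forall>x\<in>H. \<forall>y\<in>H. T (x + y) = T x + T y) \<and>
    (\<forall>a. \<forall>x\<in>H. T (a *\<^sub>C x) = a *\<^sub>C T x) \<and>
    (\<exists>B. \<forall>x\<in>H. norm (T x) \<le> B * norm x)"

definition contraction_op ::
    "'a::chilbert_space set \<Rightarrow> 'b::chilbert_space set \<Rightarrow> ('a \<Rightarrow> 'b) \<Rightarrow> bool"
  where "contraction_op H K T \<longleftrightarrow> bounded_op H K T \<and> (\<forall>x\<in>H. norm (T x) \<le> norm x)"

definition unitary_op ::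
    "'a::chilbert_space set \<Rightarrow> 'b::chilbert_space set \<Rightarrow> ('a \<Rightarrow> 'b) \<Rightarrow> bool"
  where "unitary_op H K U \<longleftrightarrow>
    bounded_op H K U \<and> U ` H = K \<and> (\<forall>x\<in>H. \<forall>y\<in>H. cinner (U x) (U y) = cinner x y)"

definition adj ::
    "'a::chilbert_space set \<Rightarrow> 'b::chilbert_space set \<Rightarrow> ('a \<Rightarrow> 'b) \<Rightarrow> 'b \<Rightarrow> 'a"
  where "adj H K T y = (THE x. x \<in> H \<and> (\<forall>z\<in>H. cinner x z = cinner y (T z)))"

definition positive_op :: "'a::chilbert_space set \<Rightarrow> ('a \<Rightarrow> 'a) \<Rightarrow> bool"
  where "positive_op H T \<longleftrightarrow> bounded_op H H T \<and> (\<forall>x\<in>H. cinner x (T x) \<in> \<real>\<^sub>\<ge>\<^sub>0)"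

text \<open>The positive square root of a positive operator \<open>T\<close> on \<open>H\<close> is unique as a function on \<open>H\<close>;
  the choice only concerns the irrelevant values outside \<open>H\<close>.\<close>

definition sqrt_op :: "'a::chilbert_space set \<Rightarrow> ('a \<Rightarrow> 'a) \<Rightarrow> 'a \<Rightarrow> 'a"
  where "sqrt_op H T = (SOME R. positive_op H R \<and> (\<forall>x\<in>H. R (R x) = T x))"

definition defect ::
    "'a::chilbert_space set \<Rightarrow> 'b::chilbert_space set \<Rightarrow> ('a \<Rightarrow> 'b) \<Rightarrow> 'a \<Rightarrow> 'a"
  where "defect H K T = sqrt_op H (\<lambda>x. x - adj H K T (T x))"

definition defect_space ::
    "'a::chilbert_space set \<Rightarrow> 'b::chilbert_space set \<Rightarrow> ('a \<Rightarrow> 'b) \<Rightarrow> 'a set"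
  where "defect_space H K T = closure (defect H K T ` H)"


section \<open>Row contractions\<close>

text \<open>Tuples are indexed by a finite type \<open>'d\<close> with \<open>d = CARD('d)\<close>, so that
  \<open>H\<^sup>d\<close> is a subspace of \<open>'h ^ 'd\<close> and words are elements of \<open>'d list\<close>.\<close>

definition power_space :: "'h set \<Rightarrow> ('h ^ 'd::finite) set"
  where "power_space H = {x. \<forall>j. x $ j \<in> H}"

definition row_op :: "('d::finite \<Rightarrow> 'h \<Rightarrow> 'k::comm_monoid_add) \<Rightarrow> 'h ^ 'd \<Rightarrow> 'k"
  where "row_op S x = (\<Sum>j\<in>UNIV. S j (x $ j))"

definition row_contraction :: "'h::chilbert_space set \<Rightarrow> ('d::finite \<Rightarrow> 'h \<Rightarrow> 'h) \<Rightarrow> bool"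
  where "row_contraction H S \<longleftrightarrow>
    (\<forall>i. bounded_op H H (S i)) \<and>
    positive_op H (\<lambda>h. h - (\<Sum>i\<in>UNIV. S i (adj H H (S i) h)))"

definition row_defect :: "'h::chilbert_space set \<Rightarrow> ('d::finite \<Rightarrow> 'h \<Rightarrow> 'h) \<Rightarrow> 'h ^ 'd \<Rightarrow> 'h ^ 'd"
  where "row_defect H S = defect (power_space H) H (row_op S)"

definition row_defect_space :: "'h::chilbert_space set \<Rightarrow> ('d::finite \<Rightarrow> 'h \<Rightarrow> 'h) \<Rightarrow> ('h ^ 'd) set"
  where "row_defect_space H S = defect_space (power_space H) H (row_op S)"

definition star_defect :: "'h::chilbert_space set \<Rightarrow> ('d::finite \<Rightarrow> 'h \<Rightarrow> 'h) \<Rightarrow> 'h \<Rightarrow> 'h"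
  where "star_defect H S = sqrt_op H (\<lambda>h. h - row_op S (adj (power_space H) H (row_op S) h))"

definition star_defect_space :: "'h::chilbert_space set \<Rightarrow> ('d::finite \<Rightarrow> 'h \<Rightarrow> 'h) \<Rightarrow> 'h set"
  where "star_defect_space H S = closure (star_defect H S ` H)"

primrec word_op :: "('d \<Rightarrow> 'h \<Rightarrow> 'h) \<Rightarrow> 'd list \<Rightarrow> 'h \<Rightarrow> 'h" where
  "word_op S [] = id"
| "word_op S (i # \<alpha>) = S i \<circ> word_op S \<alpha>"

definition generated_space :: "('d \<Rightarrow> 'h::chilbert_space \<Rightarrow> 'h) \<Rightarrow> 'h set \<Rightarrow> 'h set"
  where "generated_space S M = closure (cspan {word_op S \<alpha> x | \<alpha> x. x \<in> M})"

definition lifting ::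
    "'h::chilbert_space set \<Rightarrow> ('d \<Rightarrow> 'h \<Rightarrow> 'h) \<Rightarrow> 'h set \<Rightarrow> ('d \<Rightarrow> 'h \<Rightarrow> 'h) \<Rightarrow> bool"
  where "lifting HC C HE E \<longleftrightarrow>
    closed_csubspace HC \<and> closed_csubspace HE \<and> HC \<subseteq> HE \<and>
    (\<forall>i. bounded_op HC HC (C i)) \<and>
    (\<exists>B A. (\<forall>i. bounded_op HC (HE \<ominus> HC) (B i)) \<and>
           (\<forall>i. bounded_op (HE \<ominus> HC) (HE \<ominus> HC) (A i)) \<and>
           (\<forall>i. \<forall>c\<in>HC. \<forall>a\<in>HE \<ominus> HC. E i (c + a) = C i c + (B i c + A i a)))"

definition minimal_contractive_lifting ::
    "'h::chilbert_space set \<Rightarrow> ('d::finite \<Rightarrow> 'h \<Rightarrow> 'h) \<Rightarrow> 'h set \<Rightarrow> ('d \<Rightarrow> 'h \<Rightarrow> 'h) \<Rightarrow> bool"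
  where "minimal_contractive_lifting HC C HE E \<longleftrightarrow>
    lifting HC C HE E \<and> row_contraction HE E \<and> HE = generated_space E HC"


section \<open>The minimal isometric dilation\<close>

text \<open>The Hilbert tensor product of the full Fock space with \<open>D\<close> is realised with respect to the
  orthonormal basis \<open>e\<^sub>\<alpha>\<close>, as the square summable families of elements of \<open>D\<close> indexed by words:
  \<open>f\<close> stands for the sum of all \<open>e\<^sub>\<alpha> \<otimes> f \<alpha>\<close>.\<close>

definition fock_tensor :: "'k::chilbert_space set \<Rightarrow> ('d list, 'k) ell2 set"
  where "fock_tensor D = {f. \<forall>\<alpha>. ell2_nth f \<alpha> \<in> D}"

lift_definition vacuum_tensor :: "'k::chilbert_space \<Rightarrow> ('d list, 'k) ell2"
  is "\<lambda>k \<alpha>. if \<alpha> = [] then k else 0"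
proof -
  fix k :: 'k
  show "square_summable (\<lambda>\<alpha> :: 'd list. if \<alpha> = [] then k else 0)"
    unfolding square_summable_def
    by (rule finite_nonzero_values_imp_summable_on) (auto intro: finite_subset[of _ "{[]}"])
qed

lift_definition creation :: "'d \<Rightarrow> ('d list, 'k::chilbert_space) ell2 \<Rightarrow> ('d list, 'k) ell2"
  is "\<lambda>j f \<alpha>. case \<alpha> of [] \<Rightarrow> 0 | i # \<beta> \<Rightarrow> if i = j then f \<beta> else 0"
proof -
  fix j :: 'd and f :: "'d list \<Rightarrow> 'k"
  assume "square_summable f"
  then have "((\<lambda>\<alpha>. (norm (f (tl \<alpha>)))\<^sup>2) \<circ> Cons j) summable_on UNIV"
    by (simp add: square_summable_def o_def)
  then have "(\<lambda>\<alpha>. (norm (f (tl \<alpha>)))\<^sup>2) summable_on range (Cons j)"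
    by (subst summable_on_reindex) auto
  then show "square_summable (\<lambda>\<alpha>. case \<alpha> of [] \<Rightarrow> 0 | i # \<beta> \<Rightarrow> if i = j then f \<beta> else 0)"
    unfolding square_summable_def
    by (rule summable_on_cong_neutral[THEN iffD1, rotated -1]) (auto split: list.splits)
qed

text \<open>Only meaningful if \<open>T\<close> is bounded, so that the family is again square summable.\<close>

definition amplification ::
    "('k \<Rightarrow> 'l) \<Rightarrow> ('d list, 'k::chilbert_space) ell2 \<Rightarrow> ('d list, 'l::chilbert_space) ell2"
  where "amplification T f = Abs_ell2 (\<lambda>\<alpha>. T (ell2_nth f \<alpha>))"

type_synonym ('h, 'd) dil = "'h \<times> ('d list, 'h ^ 'd) ell2"

definition dil_space ::
    "'h::chilbert_space set \<Rightarrow> ('d::finite \<Rightarrow> 'h \<Rightarrow> 'h) \<Rightarrow> ('h, 'd) dil set"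
  where "dil_space H S = H \<times> fock_tensor (row_defect_space H S)"

definition dil ::
    "'h::chilbert_space set \<Rightarrow> ('d::finite \<Rightarrow> 'h \<Rightarrow> 'h) \<Rightarrow> 'd \<Rightarrow> ('h, 'd) dil \<Rightarrow> ('h, 'd) dil"
  where "dil H S j = (\<lambda>(h, f). (S j h, vacuum_tensor (row_defect H S (axis j h)) + creation j f))"


section \<open>The characteristic function of a lifting\<close>

definition dil_complement ::
    "'h::chilbert_space set \<Rightarrow> 'h set \<Rightarrow> ('d::finite \<Rightarrow> 'h \<Rightarrow> 'h) \<Rightarrow> ('h, 'd) dil set"
  where "dil_complement HC HE E = dil_space HE E \<ominus> generated_space (dil HE E) (HC \<times> {0})"

definition dil_unitary ::
    "'h::chilbert_space set \<Rightarrow> ('d::finite \<Rightarrow> 'h \<Rightarrow> 'h) \<Rightarrow> 'h set \<Rightarrow> ('d \<Rightarrow> 'h \<Rightarrow> 'h) \<Rightarrow>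
      (('h, 'd) dil \<Rightarrow> ('h, 'd) dil \<times> ('h, 'd) dil) \<Rightarrow> bool"
  where "dil_unitary HC C HE E W \<longleftrightarrow>
    unitary_op (dil_space HE E) (dil_space HC C \<times> dil_complement HC HE E) W \<and>
    (\<forall>h\<in>HC. W (h, 0) = ((h, 0), 0)) \<and>
    (\<forall>i. \<forall>x\<in>dil_space HE E. W (dil HE E i x) = map_prod (dil HC C i) (dil HE E i) (W x))"

text \<open>The unitary is not unique, but its component in the dilation space of \<open>C\<close> is: that
  component is determined on the closed span of all \<open>V\<^sub>\<alpha> h\<close> with \<open>h\<close> in \<open>HC\<close>, and it vanishes on
  the orthogonal complement.  Hence \<open>char_fun\<close> does not depend on the choice.\<close>

definition char_fun ::
    "'h::chilbert_space set \<Rightarrow> ('d::finite \<Rightarrow> 'h \<Rightarrow> 'h) \<Rightarrow> 'h set \<Rightarrow> ('d \<Rightarrow> 'h \<Rightarrow> 'h) \<Rightarrow>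
      ('d list, 'h ^ 'd) ell2 \<Rightarrow> ('d list, 'h ^ 'd) ell2"
  where "char_fun HC C HE E f = snd (fst ((SOME W. dil_unitary HC C HE E W) (0, f)))"

end

theory Submission
  imports Defs
begin

text \<open>
  The first component of the unitary belonging to a contractive lifting \<open>E\<close> of \<open>C\<close> is determined by
  moments: a vector \<open>p\<close> of the dilation space of \<open>C\<close> is fixed by the numbers \<open>\<langle>V\<^sup>C\<^sub>\<alpha> h, p\<rangle>\<close>, \<open>h \<in> \<H>\<^sub>C\<close>,
  and applying the unitary does not change moments, so \<open>M\<^sub>C\<^sub>E f\<close> is the unique vector with
  \<open>\<langle>V\<^sup>C\<^sub>\<alpha> h, 0 \<oplus> M\<^sub>C\<^sub>E f\<rangle> = \<langle>V\<^sup>E\<^sub>\<alpha> h, 0 \<oplus> f\<rangle>\<close> for all \<open>\<alpha>\<close> and \<open>h\<close>.  Hence moments simply pass through a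
  composition of characteristic functions.  On the subspace generated by \<open>\<H>\<^sub>C\<close>, the defining equation of
  \<open>\<sigma>\<close> says that \<open>\<sigma>\<^sup>-\<^sup>1\<close> carries the defect operator of the restriction to that of \<open>E'\<close>; so
  \<open>h \<oplus> f \<mapsto> h \<oplus> (I \<otimes> \<sigma>\<^sup>-\<^sup>1) f\<close> is an isometry intertwining the two dilations, and both sides of the
  claim have the same moments.
\<close>

section \<open>Inner products and closed subspaces\<close>

text \<open>Neither defect operators nor characteristic functions come with a formula:
  \<open>sqrt_op\<close> and \<open>char_fun\<close> are choices, and nothing can be said about them
  before a witness is known. This is why projections, adjoints, a positive square root and finally
  the unitary \<open>W\<close> are all constructed. The main fact kept about a defect operator
  \<open>D\<close> of \<open>T\<close> is the Gram identity
  \<open>cinner (D x) (D y) = cinner x y - cinner (T x) (T y)\<close>. It makes the operators of the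
  dilation isometries with orthogonal ranges, so an inner product of two words applied to vectors
  loses common first letters until one word is empty. At that point the lifting enters, in the form
  \<open>cproj HC (E j x) = C j (cproj HC x)\<close>. In this form liftings compose, which is how
  the restriction of \<open>E'\<close> is seen to lift \<open>C\<close>. The two characteristic
  functions on the right have moments over different spaces, \<open>HE\<close> for the inner one and
  \<open>HC\<close> for the outer one. Since \<open>HC\<close> lies in \<open>HE\<close>, the
  moments of the inner one are available for every vector that the outer one needs.\<close>

lemma cinner_add_right: "cinner x (y + z) = cinner x y + cinner x z"
  using cinner_commute[of x "y + z"] cinner_commute[of x y] cinner_commute[of x z]
  by (simp add: cinner_add_left)

lemma cinner_zero_left [simp]: "cinner 0 x = 0"
  using cinner_add_left[of 0 0 x] by simp

lemma cinner_zero_right [simp]: "cinner x 0 = 0"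
  using cinner_add_right[of x 0 0] by simp

lemma cinner_minus_left [simp]: "cinner (- x) y = - cinner x y"
  using cinner_add_left[of "- x" x y] by (simp add: eq_neg_iff_add_eq_0)

lemma cinner_minus_right [simp]: "cinner x (- y) = - cinner x y"
  using cinner_add_right[of x "- y" y] by (simp add: eq_neg_iff_add_eq_0)

lemma cinner_diff_left: "cinner (x - y) z = cinner x z - cinner y z"
  using cinner_add_left[of x "- y" z] by simp

lemma cinner_diff_right: "cinner x (y - z) = cinner x y - cinner x z"
  using cinner_add_right[of x y "- z"] by simp

lemma cinner_sum_left: "cinner (\<Sum>i\<in>I. f i) y = (\<Sum>i\<in>I. cinner (f i) y)"
  by (induction I rule: infinite_finite_induct) (auto simp: cinner_add_left)

lemma cinner_sum_right: "cinner y (\<Sum>i\<in>I. f i) = (\<Sum>i\<in>I. cinner y (f i))"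
  by (induction I rule: infinite_finite_induct) (auto simp: cinner_add_right)

lemma cinner_scaleR_left: "cinner (r *\<^sub>R x) y = r *\<^sub>R cinner x y"
  by (simp add: scaleR_scaleC cinner_scaleC_left scaleC_complex_def)

lemma cinner_scaleR_right: "cinner x (r *\<^sub>R y) = r *\<^sub>R cinner x y"
  by (simp add: scaleR_scaleC cinner_scaleC_right scaleC_complex_def)

lemma cinner_self: "cinner x x = of_real ((norm x)\<^sup>2)"
proof -
  have "Im (cinner x x) = 0"
    using cinner_commute[of x x] by (metis cnj.simps(2) equal_neg_zero)
  then show ?thesis
    by (simp add: complex_eq_iff power2_norm_eq_inner inner_eq_Re_cinner)
qed

lemma cinner_self_eq_0 [simp]: "cinner x x = 0 \<longleftrightarrow> x = 0"
  by (simp add: cinner_self)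

lemma cinner_eq_0_commute: "cinner x y = 0 \<longleftrightarrow> cinner y x = 0"
  using cinner_commute[of x y] by simp

lemma norm_eq_of_cinner_eq: "cinner x x = cinner y y \<Longrightarrow> norm x = norm y"
  by (simp add: cinner_self of_real_power[symmetric] del: of_real_power)

text \<open>Over the reals conjugate linearity is linearity, so the general limit and continuity
  rules for bounded bilinear maps apply.\<close>

lemma bounded_bilinear_cinner: "bounded_bilinear cinner"
  by (standard)
    (auto simp: cinner_add_left cinner_add_right cinner_scaleR_left cinner_scaleR_right
      intro!: exI[of _ 1] norm_cinner_le)

lemmas tendsto_cinner = bounded_bilinear.tendsto[OF bounded_bilinear_cinner]
lemmas continuous_on_cinner = bounded_bilinear.continuous_on[OF bounded_bilinear_cinner]

lemma bounded_linear_scaleC: "bounded_linear (\<lambda>x. a *\<^sub>C x)"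
  by (rule bounded_linear_intro[where K = "cmod a"])
    (auto simp: scaleC_add_right scaleR_scaleC scaleC_scaleC norm_scaleC mult.commute)

lemma scaleC_minus_one: "(- 1) *\<^sub>C x = - x"
  by simp

lemma closed_csubspaceI:
  assumes "0 \<in> M" "\<And>x y. x \<in> M \<Longrightarrow> y \<in> M \<Longrightarrow> x + y \<in> M" "\<And>a x. x \<in> M \<Longrightarrow> a *\<^sub>C x \<in> M" "closed M"
  shows "closed_csubspace M"
  using assms by (simp add: closed_csubspace_def complex_vector.subspace_def)

context
  fixes M :: "'a::chilbert_space set"
  assumes M: "closed_csubspace M"
begin

lemma ccs_0: "0 \<in> M"
  and ccs_add: "x \<in> M \<Longrightarrow> y \<in> M \<Longrightarrow> x + y \<in> M"
  and ccs_scaleC: "x \<in> M \<Longrightarrow> a *\<^sub>C x \<in> M"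
  and ccs_closed: "closed M"
  using M by (simp_all add: closed_csubspace_def complex_vector.subspace_def)

lemma ccs_scaleR: "x \<in> M \<Longrightarrow> r *\<^sub>R x \<in> M"
  by (simp add: scaleR_scaleC ccs_scaleC)

lemma ccs_minus: "x \<in> M \<Longrightarrow> - x \<in> M"
  using ccs_scaleC[of x "- 1"] by (simp del: complex_vector.scale_minus_left add: scaleC_minus_one)

lemma ccs_diff: "x \<in> M \<Longrightarrow> y \<in> M \<Longrightarrow> x - y \<in> M"
  using ccs_add[of x "- y"] ccs_minus[of y] by simp

lemma ccs_sum: "(\<And>i. i \<in> I \<Longrightarrow> f i \<in> M) \<Longrightarrow> (\<Sum>i\<in>I. f i) \<in> M"
  by (induction I rule: infinite_finite_induct) (auto intro: ccs_0 ccs_add)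

lemma ccs_closure_span: "S \<subseteq> M \<Longrightarrow> closure (cspan S) \<subseteq> M"
  using M by (intro closure_minimal complex_vector.span_minimal) (auto simp: closed_csubspace_def)

end

lemma csubspace_closure:
  assumes "csubspace M"
  shows "closed_csubspace (closure M)"
proof (rule closed_csubspaceI)
  show "0 \<in> closure M"
    using assms closure_subset by (auto simp: complex_vector.subspace_def)
  show "x + y \<in> closure M" if "x \<in> closure M" "y \<in> closure M" for x y
  proof -
    obtain f g where "\<forall>n. f n \<in> M" "f \<longlonglongrightarrow> x" "\<forall>n. g n \<in> M" "g \<longlonglongrightarrow> y"
      using \<open>x \<in> closure M\<close> \<open>y \<in> closure M\<close> unfolding closure_sequential by metis
    then show ?thesis
      using assms unfolding closure_sequential
      by (intro exI[of _ "\<lambda>n. f n + g n"]) (auto simp: complex_vector.subspace_def intro: tendsto_add)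
  qed
  show "a *\<^sub>C x \<in> closure M" if "x \<in> closure M" for a x
  proof -
    obtain f where "\<forall>n. f n \<in> M" "f \<longlonglongrightarrow> x"
      using \<open>x \<in> closure M\<close> unfolding closure_sequential by metis
    then show ?thesis
      using assms unfolding closure_sequential
      by (intro exI[of _ "\<lambda>n. a *\<^sub>C f n"])
        (auto simp: complex_vector.subspace_def intro: bounded_linear.tendsto[OF bounded_linear_scaleC])
  qed
qed simp

lemma closed_csubspace_closure_span: "closed_csubspace (closure (cspan S))"
  by (intro csubspace_closure complex_vector.subspace_span)

lemma subset_closure_span: "S \<subseteq> closure (cspan S)"
  using complex_vector.span_superset closure_subset by blast

lemma closed_csubspace_orth: "closed_csubspace {x. \<forall>m\<in>S. cinner m x = 0}"
proof (rule closed_csubspaceI)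
  have "closed {x. cinner m x = 0}" for m :: 'a
    by (intro closed_Collect_eq continuous_on_cinner continuous_intros)
  then show "closed {x. \<forall>m\<in>S. cinner m x = 0}"
    by (simp add: Collect_ball_eq closed_INT)
qed (auto simp: cinner_add_right cinner_scaleC_right)

lemma closed_csubspace_Int:
  "closed_csubspace M \<Longrightarrow> closed_csubspace N \<Longrightarrow> closed_csubspace (M \<inter> N)"
  by (auto intro!: closed_csubspaceI intro: ccs_0 ccs_add ccs_scaleC ccs_closed closed_Int)

lemma ominus_eq: "H \<ominus> M = H \<inter> {x. \<forall>m\<in>M. cinner m x = 0}"
  by (auto simp: ominus_def)

lemma closed_csubspace_ominus: "closed_csubspace H \<Longrightarrow> closed_csubspace (H \<ominus> M)"
  unfolding ominus_eq by (intro closed_csubspace_Int closed_csubspace_orth)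

text \<open>The vectors orthogonal to \<open>x\<close> form a closed subspace, so orthogonality can
  be checked on generators.\<close>

lemma orth_closure_span:
  assumes "\<And>s. s \<in> S \<Longrightarrow> cinner s x = 0" "y \<in> closure (cspan S)"
  shows "cinner y x = 0"
proof -
  have "S \<subseteq> {y. \<forall>m\<in>{x}. cinner m y = 0}"
    using assms(1) by (auto simp: cinner_eq_0_commute)
  from ccs_closure_span[OF closed_csubspace_orth this] show ?thesis
    using assms(2) by (auto simp: cinner_eq_0_commute)
qed

lemma closed_csubspace_Times:
  assumes "closed_csubspace M" "closed_csubspace N"
  shows "closed_csubspace (M \<times> N)"
  using assms
  by (auto intro!: closed_csubspaceI closed_Times simp: scaleC_prod_def zero_prod_def
      intro: ccs_0 ccs_add ccs_scaleC ccs_closed)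

lemma closed_csubspace_power_space:
  assumes "closed_csubspace (H :: 'h::chilbert_space set)"
  shows "closed_csubspace (power_space H :: ('h ^ 'd::finite) set)"
proof (rule closed_csubspaceI)
  have "closed ((\<lambda>x :: 'h ^ 'd. x $ j) -` H)" for j
    by (intro closed_vimage ccs_closed assms continuous_intros)
  then have "closed (\<Inter>j. (\<lambda>x :: 'h ^ 'd. x $ j) -` H)"
    by blast
  also have "(\<Inter>j. (\<lambda>x :: 'h ^ 'd. x $ j) -` H) = power_space H"
    by (auto simp: power_space_def)
  finally show "closed (power_space H :: ('h ^ 'd) set)" .
qed (auto simp: power_space_def scaleC_vec_def intro: ccs_0 ccs_add ccs_scaleC assms)


section \<open>Orthogonal projections and adjoints\<close>

text \<open>The nearest point of \<open>M\<close> to \<open>x\<close> is obtained as the limit of a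
  minimising sequence, and a variation argument shows that the error is orthogonal to
  \<open>M\<close>.\<close>

lemma projection_exists:
  fixes M :: "'a::chilbert_space set"
  assumes M: "closed_csubspace M"
  shows "\<exists>p\<in>M. \<forall>m\<in>M. cinner m (x - p) = 0"
proof -
  define d where "d = (INF m\<in>M. (norm (x - m))\<^sup>2)"
  have bdd: "bdd_below ((\<lambda>m. (norm (x - m))\<^sup>2) ` M)"
    by (rule bdd_belowI2[of _ 0]) simp
  have ne: "M \<noteq> {}"
    using ccs_0[OF M] by auto
  have d_le: "d \<le> (norm (x - m))\<^sup>2" if "m \<in> M" for m
    unfolding d_def using bdd that by (rule cINF_lower)
  have "\<exists>m\<in>M. (norm (x - m))\<^sup>2 < d + 1 / real (Suc n)" for n
    using cINF_less_iff[OF ne bdd, of "d + 1 / real (Suc n)"] unfolding d_def by simp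
  then obtain m where mM: "\<And>n. m n \<in> M" and m: "\<And>n. (norm (x - m n))\<^sup>2 < d + 1 / real (Suc n)"
    by metis
  have close: "(norm (m j - m k))\<^sup>2 \<le> 2 / real (Suc j) + 2 / real (Suc k)" for j k
  proof -
    \<comment> \<open>The midpoint stays in \<open>M\<close>, so its squared distance to
      \<open>x\<close> is at least \<open>d\<close>. The parallelogram identity for
      \<open>x - m j\<close> and \<open>x - m k\<close> turns this into a bound on
      \<open>m j - m k\<close>.\<close>
    have "(1/2) *\<^sub>R (m j + m k) \<in> M"
      by (intro ccs_scaleR ccs_add M mM)
    from d_le[OF this]
    have "4 * d \<le> 4 * (norm (x - (1/2) *\<^sub>R (m j + m k)))\<^sup>2"
      by simp
    also have "\<dots> = 2 * (norm (x - m j))\<^sup>2 + 2 * (norm (x - m k))\<^sup>2 - (norm (m j - m k))\<^sup>2"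
      by (simp add: power2_norm_eq_inner inner_diff_left inner_diff_right inner_add_left
          inner_add_right inner_commute algebra_simps)
    finally show ?thesis
      using m[of j] m[of k] by simp
  qed
  have "Cauchy m"
  proof (rule metric_CauchyI)
    fix e :: real
    assume e: "e > 0"
    obtain N where N: "4 / e\<^sup>2 < real N"
      using reals_Archimedean2 by blast
    have bound: "2 / real (Suc j) < e\<^sup>2 / 2" if "j \<ge> N" for j
    proof -
      have "4 / e\<^sup>2 < real (Suc j)" using N that by simp
      then show ?thesis using e by (simp add: field_simps)
    qed
    have "dist (m j) (m k) < e" if "j \<ge> N" "k \<ge> N" for j k
    proof -
      have "(norm (m j - m k))\<^sup>2 < e\<^sup>2"
        using close[of j k] bound[OF that(1)] bound[OF that(2)] by simp
      then show ?thesis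
        using e by (simp add: dist_norm power_less_imp_less_base)
    qed
    then show "\<exists>N. \<forall>j\<ge>N. \<forall>k\<ge>N. dist (m j) (m k) < e" by blast
  qed
  then obtain p where p: "m \<longlonglongrightarrow> p"
    using Cauchy_convergent convergentD by blast
  have pM: "p \<in> M"
    using ccs_closed[OF M] mM p closed_sequentially by blast
  have "(\<lambda>n. d + 1 / real (Suc n)) \<longlonglongrightarrow> d + 0"
    by (intro tendsto_add tendsto_const) (rule LIMSEQ_Suc[OF lim_1_over_n])
  moreover have "(\<lambda>n. (norm (x - m n))\<^sup>2) \<longlonglongrightarrow> (norm (x - p))\<^sup>2"
    by (intro tendsto_intros p)
  ultimately have pd: "(norm (x - p))\<^sup>2 \<le> d"
    using m by (intro LIMSEQ_le[of _ _ _ "d"]) (auto intro: less_imp_le)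
  have inner0: "inner k (x - p) = 0" if k: "k \<in> M" for k
  proof (cases "k = 0")
    case False
    define q where "q = inner k (x - p)"
    \<comment> \<open>The minimiser of the quadratic function of \<open>t\<close> given by the
      squared norm of \<open>(x - p) - t *\<^sub>R k\<close>.\<close>
    define t where "t = q / (norm k)\<^sup>2"
    have "p + t *\<^sub>R k \<in> M"
      by (intro ccs_add ccs_scaleR M pM k)
    from d_le[OF this] pd have "(norm (x - p))\<^sup>2 \<le> (norm ((x - p) - t *\<^sub>R k))\<^sup>2"
      by (simp add: diff_diff_eq del: power_mono_iff norm_le_square)
    also have "\<dots> = (norm (x - p))\<^sup>2 - 2 * t * q + t\<^sup>2 * (norm k)\<^sup>2"
      unfolding q_def power2_norm_eq_inner
      by (simp only: inner_diff_left inner_diff_right inner_scaleR_left inner_scaleR_right inner_commute)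
        (simp add: inner_commute algebra_simps power2_eq_square)
    also have "2 * t * q = 2 * (q\<^sup>2 / (norm k)\<^sup>2)"
      by (simp add: t_def power2_eq_square)
    also have "t\<^sup>2 * (norm k)\<^sup>2 = q\<^sup>2 / (norm k)\<^sup>2"
      using False by (simp add: t_def power2_eq_square)
    finally have "q\<^sup>2 / (norm k)\<^sup>2 \<le> 0" by simp
    moreover have "0 < (norm k)\<^sup>2"
      using False by simp
    ultimately have "q\<^sup>2 \<le> 0"
      by (metis divide_pos_pos not_le)
    then show ?thesis by (simp add: q_def)
  qed simp
  \<comment> \<open>The real orthogonality for \<open>k\<close> kills the real part, the one for
    \<open>\<i> *\<^sub>C k\<close> the imaginary part.\<close>
  have "cinner k (x - p) = 0" if k: "k \<in> M" for k
    using inner0[OF k] inner0[OF ccs_scaleC[OF M k, of \<i>]]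
    by (simp add: inner_eq_Re_cinner cinner_scaleC_left complex_eq_iff)
  with pM show ?thesis by blast
qed

lemma projection_unique:
  assumes M: "closed_csubspace M" and "p \<in> M" "q \<in> M"
    and "\<And>m. m \<in> M \<Longrightarrow> cinner m (x - p) = 0" "\<And>m. m \<in> M \<Longrightarrow> cinner m (x - q) = 0"
  shows "p = q"
proof -
  have "p - q \<in> M"
    by (intro ccs_diff assms)
  from assms(4,5)[OF this] have "cinner (p - q) ((x - q) - (x - p)) = 0"
    by (simp add: cinner_diff_right)
  then show ?thesis by simp
qed

context
  fixes M :: "'a::chilbert_space set"
  assumes M: "closed_csubspace M"
begin

lemma cproj_in_orth: "cproj M x \<in> M \<and> (\<forall>m\<in>M. cinner m (x - cproj M x) = 0)"
  unfolding cproj_def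
proof (rule theI')
  obtain p where "p \<in> M" "\<forall>m\<in>M. cinner m (x - p) = 0"
    using projection_exists[OF M, of x] by auto
  then show "\<exists>!p. p \<in> M \<and> (\<forall>m\<in>M. cinner m (x - p) = 0)"
    using projection_unique[OF M, of _ _ x] by blast
qed

lemma cproj_in: "cproj M x \<in> M"
  and cproj_orth: "m \<in> M \<Longrightarrow> cinner m (x - cproj M x) = 0"
  using cproj_in_orth by auto

lemma cproj_eqI: "p \<in> M \<Longrightarrow> (\<And>m. m \<in> M \<Longrightarrow> cinner m (x - p) = 0) \<Longrightarrow> cproj M x = p"
  using projection_unique[OF M, of _ _ x] cproj_in_orth[of x] by blast

lemma cproj_id: "x \<in> M \<Longrightarrow> cproj M x = x"
  by (rule cproj_eqI) auto

lemma cproj_orth_eq_0: "(\<And>m. m \<in> M \<Longrightarrow> cinner m x = 0) \<Longrightarrow> cproj M x = 0"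
  using ccs_0[OF M] by (intro cproj_eqI) auto

lemma cproj_add: "cproj M (x + y) = cproj M x + cproj M y"
proof (rule cproj_eqI)
  fix m assume "m \<in> M"
  then show "cinner m (x + y - (cproj M x + cproj M y)) = 0"
    using cproj_orth[of m x] cproj_orth[of m y]
    by (simp add: cinner_diff_right cinner_add_right)
qed (intro ccs_add M cproj_in)

lemma cproj_scaleC: "cproj M (a *\<^sub>C x) = a *\<^sub>C cproj M x"
proof (rule cproj_eqI)
  fix m assume "m \<in> M"
  then show "cinner m (a *\<^sub>C x - a *\<^sub>C cproj M x) = 0"
    using cproj_orth[of m x] by (simp add: cinner_diff_right cinner_scaleC_right)
qed (intro ccs_scaleC M cproj_in)

lemma cproj_ominus: "M \<subseteq> H \<Longrightarrow> closed_csubspace H \<Longrightarrow> x \<in> H \<Longrightarrow> x - cproj M x \<in> H \<ominus> M"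
  using cproj_in cproj_orth by (auto simp: ominus_def intro: ccs_diff)

text \<open>The difference \<open>x - cproj M x\<close> is orthogonal to \<open>M\<close> and hence
  vanishes. This is the test by which the minimality of the dilation is proved.\<close>

lemma eq_if_ominus_trivial:
  assumes "closed_csubspace H" "M \<subseteq> H" "\<And>x. x \<in> H \<Longrightarrow> (\<And>m. m \<in> M \<Longrightarrow> cinner m x = 0) \<Longrightarrow> x = 0"
  shows "M = H"
proof
  show "H \<subseteq> M"
  proof
    fix x assume x: "x \<in> H"
    have "x - cproj M x = 0"
      using cproj_ominus[OF assms(2,1) x] by (intro assms(3)) (auto simp: ominus_def)
    then show "x \<in> M" using cproj_in[of x] by simp
  qed
qed fact

end

section \<open>Bounded operators on a closed subspace: closed ranges and adjoints\<close>

lemma bounded_opI: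
  assumes "\<And>x. x \<in> H \<Longrightarrow> T x \<in> K"
    and "\<And>x y. x \<in> H \<Longrightarrow> y \<in> H \<Longrightarrow> T (x + y) = T x + T y"
    and "\<And>a x. x \<in> H \<Longrightarrow> T (a *\<^sub>C x) = a *\<^sub>C T x"
    and "\<And>x. x \<in> H \<Longrightarrow> norm (T x) \<le> B * norm x"
  shows "bounded_op H K T"
  using assms unfolding bounded_op_def by blast

context
  fixes H :: "'a::chilbert_space set" and K :: "'b::chilbert_space set" and T
  assumes T: "bounded_op H K T"
begin

lemma bop_in: "x \<in> H \<Longrightarrow> T x \<in> K"
  and bop_add: "x \<in> H \<Longrightarrow> y \<in> H \<Longrightarrow> T (x + y) = T x + T y"
  and bop_scaleC: "x \<in> H \<Longrightarrow> T (a *\<^sub>C x) = a *\<^sub>C T x"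
  and bop_bound: "\<exists>B. \<forall>x\<in>H. norm (T x) \<le> B * norm x"
  using T by (auto simp: bounded_op_def)

lemma bop_scaleR: "x \<in> H \<Longrightarrow> T (r *\<^sub>R x) = r *\<^sub>R T x"
  by (simp add: scaleR_scaleC bop_scaleC)

context
  assumes H: "closed_csubspace H"
begin

lemma bop_0: "T 0 = 0"
  using bop_scaleC[OF ccs_0[OF H], of 0] by simp

lemma bop_minus: "x \<in> H \<Longrightarrow> T (- x) = - T x"
  using bop_scaleC[of x "- 1"] by simp

lemma bop_diff: "x \<in> H \<Longrightarrow> y \<in> H \<Longrightarrow> T (x - y) = T x - T y"
  using bop_add[of x "- y"] bop_minus[of y] ccs_minus[OF H, of y] by simp

lemma bop_continuous: "continuous_on H T"
proof -
  obtain B where B: "\<And>x. x \<in> H \<Longrightarrow> norm (T x) \<le> B * norm x"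
    using bop_bound by blast
  have "(max B 0)-lipschitz_on H T"
  proof (rule lipschitz_onI)
    fix x y assume xy: "x \<in> H" "y \<in> H"
    have "norm (T (x - y)) \<le> B * norm (x - y)"
      by (intro B ccs_diff H xy)
    also have "\<dots> \<le> max B 0 * norm (x - y)"
      by (intro mult_right_mono) auto
    finally show "dist (T x) (T y) \<le> max B 0 * dist x y"
      using xy by (simp add: dist_norm bop_diff)
  qed simp
  then show ?thesis by (rule lipschitz_on_continuous_on)
qed

text \<open>\<open>T\<close> is known to be linear and continuous on \<open>H\<close> alone, so the
  induction over the span carries membership in \<open>H\<close> along; continuity then passes to
  the closure.\<close>

lemma bop_closure_span:
  assumes S: "S \<subseteq> H" and M: "closed_csubspace M" and TS: "\<And>s. s \<in> S \<Longrightarrow> T s \<in> M"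
    and x: "x \<in> closure (cspan S)"
  shows "T x \<in> M"
proof -
  have "s \<in> H \<and> T s \<in> M" if "s \<in> cspan S" for s
    using that
  proof (induction rule: complex_vector.span_induct_alt)
    case base
    then show ?case using ccs_0[OF H] bop_0 ccs_0[OF M] by simp
  next
    case (step a u v)
    then have "u \<in> H" "T u \<in> M" using S TS by auto
    with step have "T (a *\<^sub>C u + v) = a *\<^sub>C T u + T v"
      using ccs_scaleC[OF H] by (simp add: bop_add bop_scaleC)
    with step \<open>u \<in> H\<close> \<open>T u \<in> M\<close> show ?case
      by (simp add: ccs_add[OF H] ccs_scaleC[OF H] ccs_add[OF M] ccs_scaleC[OF M])
  qed
  then have "T ` cspan S \<subseteq> M" by auto
  moreover have "continuous_on (closure (cspan S)) T"
    by (rule continuous_on_subset[OF bop_continuous ccs_closure_span[OF H S]])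
  ultimately have "T ` closure (cspan S) \<subseteq> M"
    by (intro image_closure_subset ccs_closed M)
  then show ?thesis using x by auto
qed

lemma bop_image_csubspace: "csubspace (T ` H)"
  unfolding complex_vector.subspace_def
proof (intro conjI allI ballI impI)
  show "0 \<in> T ` H"
    using bop_0 ccs_0[OF H] by (metis image_eqI)
  fix a x y assume x: "x \<in> T ` H"
  then show "a *\<^sub>C x \<in> T ` H"
    using ccs_scaleC[OF H] by (auto simp: image_iff bop_scaleC[symmetric])
  assume "y \<in> T ` H"
  with x show "x + y \<in> T ` H"
    using ccs_add[OF H] by (auto simp: image_iff bop_add[symmetric])
qed

text \<open>The lower bound turns a convergent sequence of values into a Cauchy sequence of
  preimages, whose limit lies in \<open>H\<close>. It is applied to the two coordinate projections
  of a graph.\<close>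

lemma closed_csubspace_image:
  assumes below: "\<And>x. x \<in> H \<Longrightarrow> norm x \<le> c * norm (T x)"
  shows "closed_csubspace (T ` H)"
  unfolding closed_csubspace_def
proof
  show "closed (T ` H)"
    unfolding closed_sequential_limits
  proof (intro allI impI)
    fix Y y assume Y: "(\<forall>n. Y n \<in> T ` H) \<and> Y \<longlonglongrightarrow> y"
    then have "\<forall>n. \<exists>x. x \<in> H \<and> Y n = T x"
      by blast
    then obtain X where "\<forall>n. X n \<in> H \<and> Y n = T (X n)"
      by (rule choice[THEN exE])
    then have X: "\<And>n. X n \<in> H" and YX: "Y = (\<lambda>n. T (X n))"
      by auto
    have "Cauchy Y"
      using Y by (auto intro: LIMSEQ_imp_Cauchy)
    have "Cauchy X"
    proof (rule metric_CauchyI)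
      fix e :: real assume e: "e > 0"
      \<comment> \<open>Nothing forces \<open>c\<close> to be positive, and the bound is divided
        by.\<close>
      define c' where "c' = max c 1"
      have "c' > 0" by (simp add: c'_def)
      then obtain N where N: "\<And>m n. m \<ge> N \<Longrightarrow> n \<ge> N \<Longrightarrow> dist (Y m) (Y n) < e / c'"
        using metric_CauchyD[OF \<open>Cauchy Y\<close>, of "e / c'"] e by auto
      have "dist (X m) (X n) < e" if "m \<ge> N" "n \<ge> N" for m n
      proof -
        have "dist (X m) (X n) \<le> c * norm (T (X m - X n))"
          unfolding dist_norm by (intro below ccs_diff H X)
        also have "\<dots> \<le> c' * norm (T (X m - X n))"
          by (intro mult_right_mono) (auto simp: c'_def)
        also have "\<dots> = c' * dist (Y m) (Y n)"
          by (simp add: YX dist_norm bop_diff X)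
        also have "\<dots> < e"
          using N[OF that] \<open>c' > 0\<close> by (simp add: field_simps)
        finally show ?thesis .
      qed
      then show "\<exists>N. \<forall>m\<ge>N. \<forall>n\<ge>N. dist (X m) (X n) < e" by blast
    qed
    then obtain x where x: "X \<longlonglongrightarrow> x"
      using Cauchy_convergent convergentD by blast
    have xH: "x \<in> H"
      by (rule closed_sequentially[OF ccs_closed[OF H] _ x]) (rule X)
    have "Y \<longlonglongrightarrow> T x"
      unfolding YX
      using continuous_on_tendsto_compose[OF bop_continuous x xH] X by simp
    then have "y = T x"
      using Y LIMSEQ_unique by blast
    then show "y \<in> T ` H" using xH by blast
  qed
qed (rule bop_image_csubspace)

text \<open>Riesz representation of the functional \<open>z \<mapsto> cinner y (T z)\<close>: unless
  it vanishes on \<open>H\<close>, a suitable multiple of a vector orthogonal to its kernel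
  \<open>N\<close> represents it.\<close>

lemma adjoint_exists: "\<exists>x\<in>H. \<forall>z\<in>H. cinner x z = cinner y (T z)"
proof -
  define N where "N = {z \<in> H. cinner y (T z) = 0}"
  have N: "closed_csubspace N"
  proof (rule closed_csubspaceI)
    have "continuous_on H (\<lambda>z. cinner y (T z))"
      by (intro continuous_on_cinner continuous_on_const bop_continuous)
    from continuous_closed_preimage[OF this ccs_closed[OF H] closed_singleton[of 0]]
    have "closed (H \<inter> (\<lambda>z. cinner y (T z)) -` {0})" .
    also have "H \<inter> (\<lambda>z. cinner y (T z)) -` {0} = N"
      by (auto simp: N_def)
    finally show "closed N" .
  qed (auto simp: N_def bop_0 bop_add bop_scaleC cinner_add_right cinner_scaleC_right
      intro: ccs_0 ccs_add ccs_scaleC H)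
  show ?thesis
  proof (cases "N = H")
    case True
    then show ?thesis
      using ccs_0[OF H] by (intro bexI[of _ 0]) (auto simp: N_def)
  next
    case False
    then obtain z0 where z0: "z0 \<in> H" "z0 \<notin> N" by (auto simp: N_def)
    define w where "w = z0 - cproj N z0"
    have w: "w \<in> H" "\<And>m. m \<in> N \<Longrightarrow> cinner m w = 0"
      using cproj_ominus[OF N _ H z0(1)] by (auto simp: w_def ominus_def N_def)
    have "w \<noteq> 0"
      using cproj_in[OF N, of z0] z0 by (auto simp: w_def)
    define c where "c = cinner y (T w)"
    \<comment> \<open>For every \<open>z\<close> the combination
      \<open>c *\<^sub>C z - cinner y (T z) *\<^sub>C w\<close> lies in the kernel and is therefore
      orthogonal to \<open>w\<close>. Solving for \<open>cinner y (T z)\<close> forces this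
      coefficient; the conjugate compensates for conjugate linearity in the first argument.\<close>
    define x where "x = (cnj c / cinner w w) *\<^sub>C w"
    have "cinner x z = cinner y (T z)" if z: "z \<in> H" for z
    proof -
      let ?b = "cinner y (T z)"
      have "c *\<^sub>C z - ?b *\<^sub>C w \<in> N"
        using w(1) z ccs_scaleC[OF H]
        by (simp add: N_def bop_diff bop_scaleC cinner_diff_right cinner_scaleC_right c_def ccs_diff[OF H])
      from w(2)[OF this] have "cinner w (c *\<^sub>C z - ?b *\<^sub>C w) = 0"
        by (simp add: cinner_eq_0_commute)
      then have "c * cinner w z = ?b * cinner w w"
        by (simp add: cinner_diff_right cinner_scaleC_right)
      moreover have "cnj (cinner w w) = cinner w w"
        by (rule cinner_commute[symmetric])
      ultimately show ?thesis
        using \<open>w \<noteq> 0\<close> by (simp add: x_def cinner_scaleC_left)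
    qed
    moreover have "x \<in> H"
      unfolding x_def by (intro ccs_scaleC H w)
    ultimately show ?thesis by blast
  qed
qed

lemma adj_eqI: "x \<in> H \<Longrightarrow> (\<And>z. z \<in> H \<Longrightarrow> cinner x z = cinner y (T z)) \<Longrightarrow> adj H K T y = x"
  unfolding adj_def
proof (rule the_equality)
  fix x' assume x: "x \<in> H" "\<And>z. z \<in> H \<Longrightarrow> cinner x z = cinner y (T z)"
    and x': "x' \<in> H \<and> (\<forall>z\<in>H. cinner x' z = cinner y (T z))"
  have "x' - x \<in> H" by (intro ccs_diff H) (use x x' in auto)
  then have "cinner (x' - x) (x' - x) = 0"
    using x x' unfolding cinner_diff_left by simp
  then show "x' = x" by simp
qed auto

lemma adj_in: "adj H K T y \<in> H"
  and adj_cinner: "z \<in> H \<Longrightarrow> cinner (adj H K T y) z = cinner y (T z)"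
  using adjoint_exists[of y] adj_eqI[of _ y] by auto

lemma adj_cinner': "z \<in> H \<Longrightarrow> cinner z (adj H K T y) = cinner (T z) y"
  by (metis adj_cinner cinner_commute)

lemma adj_add: "adj H K T (x + y) = adj H K T x + adj H K T y"
  by (rule adj_eqI) (auto simp: cinner_add_left adj_cinner intro: ccs_add[OF H] adj_in)

lemma adj_scaleC: "adj H K T (a *\<^sub>C x) = a *\<^sub>C adj H K T x"
  by (rule adj_eqI) (auto simp: cinner_scaleC_left adj_cinner intro: ccs_scaleC[OF H] adj_in)

end

end

lemma bounded_op_contraction:
  assumes "contraction_op H K T"
  shows "bounded_op H K T" "x \<in> H \<Longrightarrow> norm (T x) \<le> norm x"
  using assms by (auto simp: contraction_op_def)

lemma adj_contraction:
  assumes T: "contraction_op H K T" and H: "closed_csubspace H"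
  shows "norm (adj H K T y) \<le> norm y"
proof -
  note b = bounded_op_contraction[OF T]
  let ?x = "adj H K T y"
  have x: "?x \<in> H" by (rule adj_in[OF b(1) H])
  have "cinner ?x ?x = cinner y (T ?x)"
    by (rule adj_cinner[OF b(1) H x])
  then have "(norm ?x)\<^sup>2 = cmod (cinner y (T ?x))"
    by (metis cinner_self norm_of_real abs_of_nonneg zero_le_power2)
  also have "\<dots> \<le> norm y * norm (T ?x)"
    by (rule norm_cinner_le)
  also have "\<dots> \<le> norm y * norm ?x"
    using b(2)[OF x] by (intro mult_left_mono) auto
  finally show ?thesis
    by (cases "norm ?x = 0") (auto simp: power2_eq_square)
qed


section \<open>Positive square roots\<close>

text \<open>The iteration \<open>Y\<^sub>n\<^sub>+\<^sub>1 = (B + Y\<^sub>n\<^sup>2) / 2\<close> converges in norm for every selfadjoint contraction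
  \<open>B\<close>, because its increments are dominated by those of the scalar iteration for \<open>B = 1\<close>; the
  limit \<open>Y\<close> satisfies \<open>(1 - Y)\<^sup>2 = 1 - B\<close>.\<close>

primrec sqrt_iter :: "('a::chilbert_space \<Rightarrow> 'a) \<Rightarrow> nat \<Rightarrow> 'a \<Rightarrow> 'a" where
  "sqrt_iter B 0 = (\<lambda>x. 0)"
| "sqrt_iter B (Suc n) = (\<lambda>x. (1/2) *\<^sub>R (B x + sqrt_iter B n (sqrt_iter B n x)))"

primrec sqrt_majorant :: "nat \<Rightarrow> real" where
  "sqrt_majorant 0 = 0"
| "sqrt_majorant (Suc n) = (1 + (sqrt_majorant n)\<^sup>2) / 2"

lemma sqrt_majorant_bounds: "0 \<le> sqrt_majorant n" "sqrt_majorant n \<le> 1"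
proof -
  have "0 \<le> sqrt_majorant n \<and> sqrt_majorant n \<le> 1"
    by (induction n) (auto simp: power_le_one)
  then show "0 \<le> sqrt_majorant n" "sqrt_majorant n \<le> 1" by auto
qed

lemma sqrt_majorant_Suc_ge: "sqrt_majorant n \<le> sqrt_majorant (Suc n)"
  using sum_squares_bound[of "sqrt_majorant n" 1] by simp

lemma convergent_sqrt_majorant: "convergent sqrt_majorant"
  using sqrt_majorant_bounds sqrt_majorant_Suc_ge
  by (intro Bseq_monoseq_convergent)
    (auto simp: incseq_Suc_iff simp del: sqrt_majorant.simps intro!: incseq_imp_monoseq BseqI'[of _ 1])

lemma positive_sqrt_exists:
  fixes B :: "'a::chilbert_space \<Rightarrow> 'a"
  assumes H: "closed_csubspace H" and B: "contraction_op H H B"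
    and sa: "\<And>x y. x \<in> H \<Longrightarrow> y \<in> H \<Longrightarrow> cinner x (B y) = cinner (B x) y"
  shows "\<exists>R. positive_op H R \<and> (\<forall>x\<in>H. R (R x) = x - B x)"
proof -
  note BH = bounded_op_contraction(1)[OF B]
  note B_in = bop_in[OF BH]
  let ?Y = "sqrt_iter B" and ?y = "sqrt_majorant"
  have Y_in: "?Y n x \<in> H" if "x \<in> H" for n x
    using that by (induction n arbitrary: x) (auto intro!: ccs_0 ccs_scaleR ccs_add H B_in)
  have Y_add: "?Y n (x + z) = ?Y n x + ?Y n z" if "x \<in> H" "z \<in> H" for n x z
    using that
    by (induction n arbitrary: x z) (simp_all add: Y_in bop_add[OF BH] scaleR_add_right)
  have Y_scaleC: "?Y n (a *\<^sub>C x) = a *\<^sub>C ?Y n x" if "x \<in> H" for n a x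
    using that
    by (induction n arbitrary: x)
      (simp_all add: Y_in bop_scaleC[OF BH] scaleR_scaleC scaleC_add_right scaleC_scaleC mult.commute)
  have Y_scaleR: "?Y n (r *\<^sub>R x) = r *\<^sub>R ?Y n x" if "x \<in> H" for n r x
    using that by (simp add: scaleR_scaleC Y_scaleC)
  have Y_minus: "?Y n (- x) = - ?Y n x" if "x \<in> H" for n x
    using Y_scaleR[OF that, of n "- 1"] by simp
  have Y_diff: "?Y n (x - z) = ?Y n x - ?Y n z" if "x \<in> H" "z \<in> H" for n x z
    using Y_add[of x "- z" n] Y_minus[of z n] ccs_minus[OF H, of z] that by simp
  have Y_norm: "norm (?Y n x) \<le> ?y n * norm x" if "x \<in> H" for n x
    using that
  proof (induction n arbitrary: x)
    case (Suc n)
    have "norm (?Y n (?Y n x)) \<le> ?y n * norm (?Y n x)"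
      by (intro Suc Y_in)
    also have "\<dots> \<le> ?y n * (?y n * norm x)"
      by (intro mult_left_mono Suc sqrt_majorant_bounds)
    finally have "norm (B x) + norm (?Y n (?Y n x)) \<le> norm x + (?y n)\<^sup>2 * norm x"
      using bounded_op_contraction(2)[OF B Suc.prems] by (simp add: power2_eq_square)
    then have "norm (B x + ?Y n (?Y n x)) \<le> norm x + (?y n)\<^sup>2 * norm x"
      using norm_triangle_ineq[of "B x" "?Y n (?Y n x)"] by linarith
    then show ?case
      by (simp only: sqrt_iter.simps sqrt_majorant.simps norm_scaleR) (simp add: distrib_right)
  qed simp
  have Y_contr: "norm (?Y n x) \<le> norm x" if "x \<in> H" for n x
    using Y_norm[OF that, of n] mult_right_mono[OF sqrt_majorant_bounds(2)[of n], of "norm x"] by simp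
  have Y_sa: "cinner x (?Y n z) = cinner (?Y n x) z" if "x \<in> H" "z \<in> H" for n x z
    using that
    by (induction n arbitrary: x z)
      (simp_all add: cinner_scaleR_left cinner_scaleR_right cinner_add_left cinner_add_right sa Y_in)
  have Y_B: "?Y n (B x) = B (?Y n x)" if "x \<in> H" for n x
    using that
    by (induction n arbitrary: x)
      (simp_all add: bop_0[OF BH H] bop_scaleR[OF BH] bop_add[OF BH] Y_in B_in ccs_add[OF H])
  \<comment> \<open>Every iterate is a polynomial in \<open>B\<close>. Commutation is what allows a
    difference of squares of iterates to be factored below.\<close>
  have Y_comm: "?Y n (?Y m x) = ?Y m (?Y n x)" if "x \<in> H" for n m x
    using that
  proof (induction m arbitrary: x)
    case 0
    then show ?case using Y_diff[OF 0 0, of n] by simp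
  next
    case (Suc m)
    then show ?case by (simp add: Y_scaleR Y_add Y_in Y_B B_in ccs_add[OF H])
  qed
  have Y_step: "norm (?Y (Suc n) x - ?Y n x) \<le> (?y (Suc n) - ?y n) * norm x" if "x \<in> H" for n x
    using that
  proof (induction n arbitrary: x)
    case 0
    then show ?case using bounded_op_contraction(2)[OF B, of x] Y_diff[OF 0 0, of 0] by simp
  next
    case (Suc n)
    \<comment> \<open>Factoring the difference of squares applies the difference of two iterates to
      \<open>u\<close>. The scalar recursion satisfies the same factorisation, so the bound
      reproduces itself.\<close>
    define u where "u = ?Y (Suc n) x + ?Y n x"
    have u: "u \<in> H"
      unfolding u_def by (intro ccs_add H Y_in Suc)
    have "?Y (Suc (Suc n)) x - ?Y (Suc n) x
        = (1/2) *\<^sub>R (?Y (Suc n) (?Y (Suc n) x) - ?Y n (?Y n x))"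
      unfolding sqrt_iter.simps(2)[of B "Suc n"] by (subst (3) sqrt_iter.simps) (simp add: scaleR_diff_right scaleR_add_right)
    also have "?Y (Suc n) (?Y (Suc n) x) - ?Y n (?Y n x) = ?Y (Suc n) u - ?Y n u"
      unfolding u_def
      by (simp only: Y_add[OF Y_in Y_in] Suc.prems Y_comm[OF Suc.prems, of "Suc n" n]) simp
    finally have "norm (?Y (Suc (Suc n)) x - ?Y (Suc n) x) = norm (?Y (Suc n) u - ?Y n u) / 2"
      by simp
    also have "norm (?Y (Suc n) u - ?Y n u) \<le> (?y (Suc n) - ?y n) * norm u"
      by (rule Suc.IH[OF u])
    also have "norm u \<le> (?y (Suc n) + ?y n) * norm x"
      unfolding u_def
      using norm_triangle_ineq[of "?Y (Suc n) x" "?Y n x"] Y_norm[OF Suc.prems, of n]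
        Y_norm[OF Suc.prems, of "Suc n"]
      by (simp only: distrib_right)
    finally have "norm (?Y (Suc (Suc n)) x - ?Y (Suc n) x)
        \<le> (?y (Suc n) - ?y n) * ((?y (Suc n) + ?y n) * norm x) / 2"
      using sqrt_majorant_Suc_ge[of n] by (simp add: mult_left_mono)
    also have "\<dots> = (?y (Suc (Suc n)) - ?y (Suc n)) * norm x"
      using sqrt_majorant.simps(2)[of "Suc n"] sqrt_majorant.simps(2)[of n]
      by (simp add: field_simps power2_eq_square)
    finally show ?case .
  qed
  have Y_tail: "norm (?Y (n + k) x - ?Y n x) \<le> (?y (n + k) - ?y n) * norm x" if "x \<in> H" for n k x
  proof (induction k)
    case (Suc k)
    have "norm (?Y (n + Suc k) x - ?Y n x)
        \<le> norm (?Y (Suc (n + k)) x - ?Y (n + k) x) + norm (?Y (n + k) x - ?Y n x)"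
      using norm_triangle_ineq[of "?Y (Suc (n + k)) x - ?Y (n + k) x" "?Y (n + k) x - ?Y n x"]
      by (simp del: sqrt_iter.simps)
    also have "\<dots> \<le> (?y (Suc (n + k)) - ?y (n + k)) * norm x + (?y (n + k) - ?y n) * norm x"
      by (intro add_mono Y_step that Suc)
    finally show ?case by (simp add: algebra_simps del: sqrt_iter.simps sqrt_majorant.simps)
  qed simp
  have Y_conv: "convergent (\<lambda>n. ?Y n x)" if x: "x \<in> H" for x
  proof -
    have "Cauchy ?y"
      by (intro convergent_Cauchy convergent_sqrt_majorant)
    have "Cauchy (\<lambda>n. ?Y n x)"
    proof (rule metric_CauchyI)
      fix e :: real
      assume e: "e > 0"
      then obtain N where N: "\<And>m n. m \<ge> N \<Longrightarrow> n \<ge> N \<Longrightarrow> dist (?y m) (?y n) < e / (norm x + 1)"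
        using metric_CauchyD[OF \<open>Cauchy ?y\<close>, of "e / (norm x + 1)"]
        by (metis add_nonneg_pos divide_pos_pos norm_ge_zero zero_less_one)
      have *: "dist (?Y m x) (?Y n x) < e" if "N \<le> n" "n \<le> m" for m n
      proof -
        have "dist (?Y m x) (?Y n x) \<le> (?y m - ?y n) * norm x"
          using Y_tail[OF x, of n "m - n"] that by (simp add: dist_norm)
        also have "\<dots> \<le> e / (norm x + 1) * norm x"
          using N[of m n] that by (intro mult_right_mono) (auto simp: dist_real_def)
        also have "\<dots> < e"
          using e add_nonneg_pos[OF norm_ge_zero[of x] zero_less_one] by (simp add: field_simps)
        finally show ?thesis .
      qed
      have "dist (?Y m x) (?Y n x) < e" if "N \<le> m" "N \<le> n" for m n
        using *[of n m] *[of m n] that by (cases "n \<le> m") (auto simp: dist_commute)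
      then show "\<exists>N. \<forall>m\<ge>N. \<forall>n\<ge>N. dist (?Y m x) (?Y n x) < e" by blast
    qed
    then show ?thesis by (rule Cauchy_convergent)
  qed
  define L where "L x = lim (\<lambda>n. ?Y n x)" for x
  have L: "(\<lambda>n. ?Y n x) \<longlonglongrightarrow> L x" if "x \<in> H" for x
    using Y_conv[OF that] by (simp add: L_def convergent_LIMSEQ_iff)
  have L_in: "L x \<in> H" if "x \<in> H" for x
    by (rule closed_sequentially[OF ccs_closed[OF H] _ L[OF that]]) (rule Y_in[OF that])
  have L_contr: "norm (L x) \<le> norm x" if "x \<in> H" for x
    by (rule LIMSEQ_le_const2[OF tendsto_norm[OF L[OF that]]]) (use Y_contr[OF that] in auto)
  have L_add: "L (x + z) = L x + L z" if "x \<in> H" "z \<in> H" for x z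
    using LIMSEQ_unique[OF L[OF ccs_add[OF H that]]]
      tendsto_add[OF L[OF that(1)] L[OF that(2)]] by (simp only: Y_add[OF that])
  have L_scaleC: "L (a *\<^sub>C x) = a *\<^sub>C L x" if "x \<in> H" for a x
    using LIMSEQ_unique[OF L[OF ccs_scaleC[OF H that]]]
      bounded_linear.tendsto[OF bounded_linear_scaleC L[OF that]] by (simp only: Y_scaleC[OF that])
  have L_sa: "cinner x (L z) = cinner (L x) z" if "x \<in> H" "z \<in> H" for x z
    using LIMSEQ_unique[OF tendsto_cinner[OF tendsto_const L[OF that(2)]]]
      tendsto_cinner[OF L[OF that(1)] tendsto_const] by (simp only: Y_sa[OF that])
  have L_sq: "2 *\<^sub>R L x = B x + L (L x)" if x: "x \<in> H" for x
  proof -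
    \<comment> \<open>The limit of the squares is found by splitting \<open>?Y n x\<close> into
      \<open>?Y n x - L x\<close> and \<open>L x\<close>; since all iterates are contractions, the
      first part disappears.\<close>
    have "(\<lambda>n. ?Y n (?Y n x - L x)) \<longlonglongrightarrow> 0"
    proof (rule Lim_null_comparison)
      show "\<forall>\<^sub>F n in sequentially. norm (?Y n (?Y n x - L x)) \<le> norm (?Y n x - L x)"
        by (intro always_eventually allI Y_contr ccs_diff H Y_in L_in x)
      show "(\<lambda>n. norm (?Y n x - L x)) \<longlonglongrightarrow> 0"
        using L[OF x] by (simp add: tendsto_norm_zero LIM_zero)
    qed
    then have "(\<lambda>n. ?Y n (?Y n x - L x) + ?Y n (L x)) \<longlonglongrightarrow> 0 + L (L x)"
      by (intro tendsto_add L L_in x)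
    then have "(\<lambda>n. ?Y n (?Y n x)) \<longlonglongrightarrow> L (L x)"
      by (simp add: Y_diff Y_in L_in x)
    then have "(\<lambda>n. ?Y (Suc n) x) \<longlonglongrightarrow> (1/2) *\<^sub>R (B x + L (L x))"
      by (auto intro!: tendsto_intros)
    from LIMSEQ_unique[OF LIMSEQ_Suc[OF L[OF x]] this]
    have "2 *\<^sub>R L x = 2 *\<^sub>R ((1/2) *\<^sub>R (B x + L (L x)))"
      by (rule arg_cong)
    then show ?thesis by (simp only: scaleR_scaleR) simp
  qed
  define R where "R x = x - L x" for x
  have "positive_op H R"
    unfolding positive_op_def
  proof
    show "bounded_op H H R"
    proof (rule bounded_opI[where B = 2])
      show "norm (R x) \<le> 2 * norm x" if "x \<in> H" for x
        using norm_triangle_ineq4[of x "L x"] L_contr[OF that] by (simp add: R_def)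
    qed (auto simp: R_def L_add L_scaleC complex_vector.scale_right_diff_distrib
        intro: ccs_diff[OF H] L_in)
    show "\<forall>x\<in>H. cinner x (R x) \<in> \<real>\<^sub>\<ge>\<^sub>0"
    proof
      fix x assume x: "x \<in> H"
      \<comment> \<open>\<open>L\<close> is a selfadjoint contraction, so
        \<open>cinner x (L x)\<close> is real and at most the square of \<open>norm x\<close>. This
        is the positivity of \<open>R\<close>.\<close>
      have "Im (cinner x (L x)) = 0"
        using L_sa[OF x x] cinner_commute[of x "L x"] by (metis cnj.simps(2) equal_neg_zero)
      moreover have "Re (cinner x (L x)) \<le> (norm x)\<^sup>2"
        using complex_Re_le_cmod[of "cinner x (L x)"] norm_cinner_le[of x "L x"]
          mult_left_mono[OF L_contr[OF x], of "norm x"]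
        by (simp add: power2_eq_square)
      ultimately show "cinner x (R x) \<in> \<real>\<^sub>\<ge>\<^sub>0"
        by (simp add: R_def cinner_diff_right cinner_self complex_nonneg_Reals_iff)
    qed
  qed
  moreover have "R (R x) = x - B x" if x: "x \<in> H" for x
  proof -
    have "L (x - L x) = L x - L (L x)"
      using L_add[OF x, of "(- 1) *\<^sub>C L x"] L_scaleC[OF L_in[OF x], of "- 1"]
        ccs_scaleC[OF H L_in[OF x], of "- 1"] by simp
    moreover have "B x = L x + L x - L (L x)"
      using L_sq[OF x] by (simp add: scaleR_2)
    ultimately show ?thesis by (simp add: R_def)
  qed
  ultimately show ?thesis by blast
qed

text \<open>Polarisation: the quadratic form is real at every \<open>x + a *\<^sub>C y\<close>, and
  comparing \<open>a = 1\<close> with \<open>a = \<i>\<close> separates the two mixed terms.\<close>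

lemma positive_op_selfadjoint:
  assumes R: "positive_op H R" and H: "closed_csubspace H" and x: "x \<in> H" and y: "y \<in> H"
  shows "cinner (R x) y = cinner x (R y)"
proof -
  have RB: "bounded_op H H R"
    using R by (simp add: positive_op_def)
  have sym: "cinner (R z) z = cinner z (R z)" if "z \<in> H" for z
    using R that cinner_commute[of "R z" z]
    by (auto simp: positive_op_def nonneg_Reals_def)
  have "cinner (R (x + a *\<^sub>C y)) (x + a *\<^sub>C y) = cinner (x + a *\<^sub>C y) (R (x + a *\<^sub>C y))" for a
    by (intro sym ccs_add ccs_scaleC H x y)
  then have *: "a * cinner (R x) y + cnj a * cinner (R y) x = a * cinner x (R y) + cnj a * cinner y (R x)"
    for a
    using sym[OF x] sym[OF y] ccs_scaleC[OF H y] x y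
    by (simp add: bop_add[OF RB] bop_scaleC[OF RB] cinner_add_left cinner_add_right
        cinner_scaleC_left cinner_scaleC_right algebra_simps)
  have "\<i> * (cinner (R x) y - cinner (R y) x) = \<i> * (cinner x (R y) - cinner y (R x))"
    using *[of \<i>] by (simp add: algebra_simps)
  then have "cinner (R x) y - cinner (R y) x = cinner x (R y) - cinner y (R x)"
    by simp
  with *[of 1] show ?thesis
    by (simp add: algebra_simps complex_eq_iff)
qed

text \<open>A root of \<open>x - B x\<close>, with \<open>B\<close> the adjoint of \<open>T\<close>
  composed with \<open>T\<close>, shows that the choice in \<open>sqrt_op\<close> has the defining
  properties. Selfadjointness then moves one factor across the inner product, where the square of
  the defect operator is known.\<close>

lemma
  assumes T: "contraction_op H K T" and H: "closed_csubspace H"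
  shows defect_bounded_op: "bounded_op H H (defect H K T)"
    and defect_cinner: "\<And>x y. x \<in> H \<Longrightarrow> y \<in> H \<Longrightarrow>
      cinner (defect H K T x) (defect H K T y) = cinner x y - cinner (T x) (T y)"
proof -
  note TB = bounded_op_contraction(1)[OF T]
  define B where "B x = adj H K T (T x)" for x
  have B: "contraction_op H H B"
    unfolding contraction_op_def
  proof
    have contr: "norm (B x) \<le> norm x" if "x \<in> H" for x
      using adj_contraction[OF T H, of "T x"] bounded_op_contraction(2)[OF T that]
      unfolding B_def by linarith
    show "bounded_op H H B"
      by (rule bounded_opI[where B = 1])
        (auto simp: contr, auto simp: B_def bop_add[OF TB] bop_scaleC[OF TB] adj_in[OF TB H]
          adj_add[OF TB H] adj_scaleC[OF TB H])
    show "\<forall>x\<in>H. norm (B x) \<le> norm x"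
      using contr by blast
  qed
  have B_cinner: "cinner x (B y) = cinner (T x) (T y)" "cinner (B x) y = cinner (T x) (T y)"
    if "x \<in> H" "y \<in> H" for x y
    using that by (simp_all add: B_def adj_cinner[OF TB H] adj_cinner'[OF TB H])
  have "\<exists>R. positive_op H R \<and> (\<forall>x\<in>H. R (R x) = x - B x)"
    by (rule positive_sqrt_exists[OF H B]) (simp add: B_cinner)
  from someI_ex[OF this]
  have D: "positive_op H (defect H K T)" "\<And>x. x \<in> H \<Longrightarrow> defect H K T (defect H K T x) = x - B x"
    unfolding defect_def sqrt_op_def B_def by blast+
  show DB: "bounded_op H H (defect H K T)"
    using D by (simp add: positive_op_def)
  show "cinner (defect H K T x) (defect H K T y) = cinner x y - cinner (T x) (T y)"
    if "x \<in> H" "y \<in> H" for x y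
    using positive_op_selfadjoint[OF D(1) H that(1) bop_in[OF DB that(2)]] D(2)[OF that(2)] that
    by (simp add: cinner_diff_right B_cinner)
qed

lemma closed_csubspace_defect_space:
  assumes T: "contraction_op H K T" and H: "closed_csubspace H"
  shows "closed_csubspace (defect_space H K T)"
  unfolding defect_space_def
  by (intro csubspace_closure bop_image_csubspace[OF defect_bounded_op[OF T H] H])


section \<open>Row contractions\<close>

lemma row_op_contraction:
  fixes S :: "'d::finite \<Rightarrow> 'h::chilbert_space \<Rightarrow> 'h"
  assumes "closed_csubspace H" "\<And>i. bounded_op H H (S i)"
    and "\<And>x. x \<in> power_space H \<Longrightarrow> norm (row_op S x) \<le> norm x"
  shows "contraction_op (power_space H) H (row_op S)"
  unfolding contraction_op_def
proof
  show "bounded_op (power_space H) H (row_op S)"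
  proof (rule bounded_opI[where B = 1])
    fix x y :: "'h ^ 'd" and a assume xy: "x \<in> power_space H" "y \<in> power_space H"
    then have xyj: "x $ j \<in> H" "y $ j \<in> H" for j by (auto simp: power_space_def)
    show "row_op S x \<in> H"
      unfolding row_op_def by (intro ccs_sum assms(1) bop_in[OF assms(2)] xyj)
    show "row_op S (x + y) = row_op S x + row_op S y"
      by (simp add: row_op_def bop_add[OF assms(2)] xyj sum.distrib)
  next
    fix x :: "'h ^ 'd" and a assume "x \<in> power_space H"
    then have xj: "x $ j \<in> H" for j by (auto simp: power_space_def)
    show "row_op S (a *\<^sub>C x) = a *\<^sub>C row_op S x"
      by (simp add: row_op_def scaleC_vec_def bop_scaleC[OF assms(2)] xj complex_vector.scale_sum_right)
  qed (use assms in auto)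
qed (use assms in auto)

text \<open>An operator and its adjoint have the same norm, which links the positivity condition to
  contractivity of the row. The norm form is the one that survives restriction to an invariant
  subspace.\<close>

lemma row_contraction_iff:
  fixes S :: "'d::finite \<Rightarrow> 'h::chilbert_space \<Rightarrow> 'h"
  assumes H: "closed_csubspace H"
  shows "row_contraction H S \<longleftrightarrow>
    (\<forall>i. bounded_op H H (S i)) \<and> (\<forall>x\<in>power_space H. norm (row_op S x) \<le> norm x)"
proof (cases "\<forall>i. bounded_op H H (S i)")
  case True
  then have S: "bounded_op H H (S i)" for i by blast
  \<comment> \<open>The column of the entrywise adjoints is the adjoint of the row operator, so
    \<open>cinner y (Q y)\<close> is the squared norm of \<open>Z y\<close>.\<close>
  define Z where "Z y = (\<chi> i. adj H H (S i) y)" for y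
  define Q where "Q y = (\<Sum>i\<in>UNIV. S i (adj H H (S i) y))" for y
  have Z_in: "Z y \<in> power_space H" for y
    by (simp add: Z_def power_space_def adj_in[OF S H])
  have Q: "Q y = row_op S (Z y)" for y
    by (simp add: Q_def Z_def row_op_def)
  have Z: "cinner (Z y) x = cinner y (row_op S x)" if "x \<in> power_space H" for x y
    using that by (simp add: Z_def cinner_vec_def row_op_def cinner_sum_right adj_cinner[OF S H]
        power_space_def)
  have yQ: "cinner y (Q y) = of_real ((norm (Z y))\<^sup>2)" for y
    by (simp only: Q Z[OF Z_in, symmetric] cinner_self)
  have pos: "cinner y (y - Q y) \<in> \<real>\<^sub>\<ge>\<^sub>0 \<longleftrightarrow> norm (Z y) \<le> norm y" for y
    by (simp add: cinner_diff_right yQ cinner_self complex_nonneg_Reals_iff abs_le_square_iff[symmetric])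
  have le1: "norm (row_op S x) \<le> norm x"
    if "norm (Z (row_op S x)) \<le> norm (row_op S x)" "x \<in> power_space H" for x
  proof -
    let ?y = "row_op S x"
    have "(norm ?y)\<^sup>2 = cmod (cinner (Z ?y) x)"
      by (simp add: Z that cinner_self norm_power)
    also have "\<dots> \<le> norm ?y * norm x"
      by (rule order_trans[OF norm_cinner_le]) (simp add: that mult_right_mono)
    finally show ?thesis
      by (cases "norm ?y = 0") (auto simp: power2_eq_square)
  qed
  have le2: "norm (Z y) \<le> norm y" if "\<forall>x\<in>power_space H. norm (row_op S x) \<le> norm x" for y
  proof -
    have "(norm (Z y))\<^sup>2 = cmod (cinner y (Q y))"
      by (simp add: yQ norm_power)
    also have "\<dots> \<le> norm y * norm (Z y)"
      using that Z_in[of y]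
      by (intro order_trans[OF norm_cinner_le]) (simp add: Q mult_left_mono)
    finally show ?thesis
      by (cases "norm (Z y) = 0") (auto simp: power2_eq_square)
  qed
  have row_in: "row_op S x \<in> H" if "x \<in> power_space H" for x
    using that unfolding row_op_def power_space_def by (intro ccs_sum H bop_in[OF S]) auto
  have "bounded_op H H (\<lambda>y. y - Q y)" if c: "\<forall>x\<in>power_space H. norm (row_op S x) \<le> norm x"
  proof (rule bounded_opI[where B = 2])
    fix y assume "y \<in> H"
    show "norm (y - Q y) \<le> 2 * norm y"
      using norm_triangle_ineq4[of y "Q y"] c Z_in[of y] le2[OF c, of y] Q[of y] by fastforce
    show "y - Q y \<in> H"
      using \<open>y \<in> H\<close> Z_in unfolding Q by (intro ccs_diff H row_in) auto
  qed (simp_all add: Q_def adj_add[OF S H] adj_scaleC[OF S H] bop_add[OF S] bop_scaleC[OF S]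
      adj_in[OF S H] sum.distrib complex_vector.scale_sum_right complex_vector.scale_right_diff_distrib)
  then show ?thesis
    using True pos le1 le2 row_in
    unfolding row_contraction_def positive_op_def Q_def[symmetric] by blast
qed (auto simp: row_contraction_def)

lemma row_contraction_contraction_op:
  assumes "closed_csubspace H" "row_contraction H S"
  shows "contraction_op (power_space H) H (row_op S)"
  using assms by (intro row_op_contraction) (auto simp: row_contraction_iff)


section \<open>Isometric extension\<close>

text \<open>The extension is read off its graph, which is the closed span of the pairs \<open>(u i, v i)\<close>.\<close>

lemma isometric_extension:
  fixes u :: "'i \<Rightarrow> 'a::chilbert_space" and v :: "'i \<Rightarrow> 'b::chilbert_space"
  assumes gram: "\<And>i j. i \<in> I \<Longrightarrow> j \<in> I \<Longrightarrow> cinner (u i) (u j) = cinner (v i) (v j)"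
  shows "\<exists>U. unitary_op (closure (cspan (u ` I))) (closure (cspan (v ` I))) U \<and> (\<forall>i\<in>I. U (u i) = v i)"
proof -
  define S where "S = (\<lambda>i. (u i, v i)) ` I"
  define G where "G = closure (cspan S)"
  \<comment> \<open>An indefinite form: \<open>cinner p (J q) = 0\<close> says that first and second
    components have equal inner products. As an orthogonality relation it passes from the generators
    to the closed span, one argument at a time.\<close>
  define J where "J p = (fst p, - snd p)" for p :: "'a \<times> 'b"
  have J: "cinner p (J q) = cinner (fst p) (fst q) - cinner (snd p) (snd q)" for p q
    by (simp add: J_def cinner_prod_def)
  have J_sym: "cinner p (J q) = 0 \<longleftrightarrow> cinner q (J p) = 0" for p q
    using cinner_commute[of "J q" p] cinner_eq_0_commute[of p "J q"]
    by (simp add: J_def cinner_prod_def)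
  have G: "closed_csubspace G"
    unfolding G_def by (rule closed_csubspace_closure_span)
  have S_G: "S \<subseteq> G"
    unfolding G_def by (rule subset_closure_span)
  have "cinner p (J q) = 0" if "p \<in> G" "q \<in> G" for p q
  proof (rule orth_closure_span[OF _ \<open>p \<in> G\<close>[unfolded G_def]])
    fix s assume s: "s \<in> S"
    have "cinner q (J s) = 0"
    proof (rule orth_closure_span[OF _ \<open>q \<in> G\<close>[unfolded G_def]])
      fix t assume "t \<in> S"
      with s show "cinner t (J s) = 0"
        by (auto simp: S_def J gram)
    qed
    then show "cinner s (J q) = 0"
      by (simp add: J_sym[of s q])
  qed
  then have iso: "cinner (fst p) (fst q) = cinner (snd p) (snd q)" if "p \<in> G" "q \<in> G" for p q
    using that by (simp add: J)
  have norm_iso: "norm (snd p) = norm (fst p)" if "p \<in> G" for p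
    using iso[OF that that] by (rule norm_eq_of_cinner_eq[symmetric])
  have fst_op: "bounded_op G UNIV fst"
    by (rule bounded_opI[where B = 1]) (simp_all add: scaleC_prod_def, metis norm_fst_le prod.collapse)
  have snd_op: "bounded_op G UNIV snd"
    by (rule bounded_opI[where B = 1]) (simp_all add: scaleC_prod_def, metis norm_snd_le prod.collapse)
  \<comment> \<open>On the graph either component controls the whole vector, so both coordinate
    projections have closed range.\<close>
  have below: "norm p \<le> 2 * norm (fst p)" if "p \<in> G" for p
    using norm_Pair_le[of "fst p" "snd p"] norm_iso[OF that] by simp
  have dom: "fst ` G = closure (cspan (u ` I))"
  proof
    show "fst ` G \<subseteq> closure (cspan (u ` I))"
    proof (rule image_subsetI)
      fix p assume p: "p \<in> G"
      have "fst s \<in> closure (cspan (u ` I))" if "s \<in> S" for s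
        using subset_closure_span[of "u ` I"] that by (auto simp: S_def)
      from bop_closure_span[OF fst_op G S_G closed_csubspace_closure_span this p[unfolded G_def]]
      show "fst p \<in> closure (cspan (u ` I))" .
    qed
    have "closed_csubspace (fst ` G)"
      using fst_op G below by (rule closed_csubspace_image)
    moreover have "u ` I \<subseteq> fst ` G"
      using S_G by (force simp: S_def)
    ultimately show "closure (cspan (u ` I)) \<subseteq> fst ` G"
      by (rule ccs_closure_span)
  qed
  have ran: "snd ` G = closure (cspan (v ` I))"
  proof
    show "snd ` G \<subseteq> closure (cspan (v ` I))"
    proof (rule image_subsetI)
      fix p assume p: "p \<in> G"
      have "snd s \<in> closure (cspan (v ` I))" if "s \<in> S" for s
        using subset_closure_span[of "v ` I"] that by (auto simp: S_def)
      from bop_closure_span[OF snd_op G S_G closed_csubspace_closure_span this p[unfolded G_def]]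
      show "snd p \<in> closure (cspan (v ` I))" .
    qed
    have "norm p \<le> 2 * norm (snd p)" if "p \<in> G" for p
      using below[OF that] norm_iso[OF that] by simp
    with snd_op G have "closed_csubspace (snd ` G)"
      by (rule closed_csubspace_image)
    moreover have "v ` I \<subseteq> snd ` G"
      using S_G by (force simp: S_def)
    ultimately show "closure (cspan (v ` I)) \<subseteq> snd ` G"
      by (rule ccs_closure_span)
  qed
  define U where "U x = snd (SOME p. p \<in> G \<and> fst p = x)" for x
  \<comment> \<open>The choice is harmless: two points of the graph over the same vector differ by
    one with first component zero, whose second component has the same norm.\<close>
  have U: "U (fst p) = snd p" if p: "p \<in> G" for p
  proof -
    define q where "q = (SOME q. q \<in> G \<and> fst q = fst p)"
    have q: "q \<in> G \<and> fst q = fst p"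
      unfolding q_def by (rule someI[of _ p]) (simp add: p)
    then have "norm (snd (q - p)) = norm (fst (q - p))"
      using p by (intro norm_iso ccs_diff G) auto
    with q show ?thesis by (simp add: U_def q_def[symmetric])
  qed
  have "unitary_op (fst ` G) (snd ` G) U"
    unfolding unitary_op_def
  proof (intro conjI ballI)
    show "bounded_op (fst ` G) (snd ` G) U"
    proof (rule bounded_opI[where B = 1])
      show "U x \<in> snd ` G" "norm (U x) \<le> 1 * norm x" if "x \<in> fst ` G" for x
      proof -
        obtain p where "p \<in> G" "x = fst p"
          using \<open>x \<in> fst ` G\<close> by auto
        then show "U x \<in> snd ` G" "norm (U x) \<le> 1 * norm x"
          by (simp_all add: U norm_iso)
      qed
      show "U (x + y) = U x + U y" if "x \<in> fst ` G" "y \<in> fst ` G" for x y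
      proof -
        obtain p q where "p \<in> G" "x = fst p" "q \<in> G" "y = fst q"
          using \<open>x \<in> fst ` G\<close> \<open>y \<in> fst ` G\<close> by auto
        then show ?thesis using U[OF ccs_add[OF G, of p q]] by (simp add: U)
      qed
      show "U (a *\<^sub>C x) = a *\<^sub>C U x" if "x \<in> fst ` G" for a x
      proof -
        obtain p where "p \<in> G" "x = fst p"
          using \<open>x \<in> fst ` G\<close> by auto
        then show ?thesis using U[OF ccs_scaleC[OF G, of p a]] by (simp add: U scaleC_prod_def)
      qed
    qed
    show "U ` fst ` G = snd ` G"
      unfolding image_image by (rule image_cong[OF refl U])
    show "cinner (U x) (U y) = cinner x y" if "x \<in> fst ` G" "y \<in> fst ` G" for x y
    proof -
      obtain p q where "p \<in> G" "x = fst p" "q \<in> G" "y = fst q"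
        using \<open>x \<in> fst ` G\<close> \<open>y \<in> fst ` G\<close> by auto
      then show ?thesis by (simp add: U iso)
    qed
  qed
  moreover have "U (u i) = v i" if "i \<in> I" for i
    using U[of "(u i, v i)"] S_G that by (auto simp: S_def)
  ultimately show ?thesis
    unfolding dom ran by blast
qed

lemma unitary_op_cinner:
  "unitary_op H K U \<Longrightarrow> x \<in> H \<Longrightarrow> y \<in> H \<Longrightarrow> cinner (U x) (U y) = cinner x y"
  by (simp add: unitary_op_def)


section \<open>The minimal isometric dilation\<close>

lemma word_op_in: "(\<And>i x. x \<in> H \<Longrightarrow> S i x \<in> H) \<Longrightarrow> x \<in> H \<Longrightarrow> word_op S \<alpha> x \<in> H"
  by (induction \<alpha>) auto

lemma word_op_append: "word_op S (\<alpha> @ \<beta>) x = word_op S \<alpha> (word_op S \<beta> x)"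
  by (induction \<alpha>) auto

lemma word_op_add:
  assumes "\<And>i. bounded_op H H (S i)" "x \<in> H" "y \<in> H"
  shows "word_op S \<alpha> (x + y) = word_op S \<alpha> x + word_op S \<alpha> y"
proof (induction \<alpha>)
  case (Cons i \<alpha>)
  have "word_op S \<alpha> x \<in> H" "word_op S \<alpha> y \<in> H"
    using assms bop_in[OF assms(1)] by (auto intro: word_op_in)
  with Cons show ?case by (simp add: bop_add[OF assms(1)])
qed simp

lemma word_op_in_generated: "x \<in> M \<Longrightarrow> word_op S \<alpha> x \<in> generated_space S M"
  unfolding generated_space_def by (rule subsetD[OF subset_closure_span]) blast

lemma closed_csubspace_generated: "closed_csubspace (generated_space S M)"
  unfolding generated_space_def by (rule closed_csubspace_closure_span)

lemma generated_space_subset: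
  assumes "closed_csubspace H" "\<And>i x. x \<in> H \<Longrightarrow> S i x \<in> H" "M \<subseteq> H"
  shows "generated_space S M \<subseteq> H"
  unfolding generated_space_def using assms by (intro ccs_closure_span) (auto intro: word_op_in)

lemma generated_space_invariant:
  assumes H: "closed_csubspace H" and S: "\<And>i. bounded_op H H (S i)" and M: "M \<subseteq> H"
    and x: "x \<in> generated_space S M"
  shows "S i x \<in> generated_space S M"
proof (rule bop_closure_span[OF S H _ closed_csubspace_generated])
  show "{word_op S \<alpha> x |\<alpha> x. x \<in> M} \<subseteq> H"
    using M bop_in[OF S] by (auto intro: word_op_in)
  show "S i s \<in> generated_space S M" if s: "s \<in> {word_op S \<alpha> x |\<alpha> x. x \<in> M}" for s
  proof -
    obtain \<alpha> y where "s = word_op S \<alpha> y" "y \<in> M" using s by blast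
    then show ?thesis using word_op_in_generated[of y M S "i # \<alpha>"] by simp
  qed
  show "x \<in> closure (cspan {word_op S \<alpha> x |\<alpha> x. x \<in> M})"
    using x by (simp add: generated_space_def)
qed

text \<open>The elementary tensor \<open>e\<^sub>\<alpha> \<otimes> k\<close>. Pairing with it
  extracts the coefficient at \<open>\<alpha>\<close>.\<close>

lift_definition ell2_basis :: "'i \<Rightarrow> 'k::chilbert_space \<Rightarrow> ('i, 'k) ell2"
  is "\<lambda>\<alpha> k \<beta>. if \<beta> = \<alpha> then k else 0"
proof -
  fix \<alpha> :: 'i and k :: 'k
  show "square_summable (\<lambda>\<beta>. if \<beta> = \<alpha> then k else 0)"
    unfolding square_summable_def
    by (rule finite_nonzero_values_imp_summable_on) (auto intro: finite_subset[of _ "{\<alpha>}"])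
qed

lemma cinner_ell2_basis: "cinner (ell2_basis \<alpha> k) f = cinner k (ell2_nth f \<alpha>)"
proof -
  have "cinner (ell2_basis \<alpha> k) f
      = (\<Sum>\<^sub>\<infinity>\<beta>. if \<beta> = \<alpha> then cinner k (ell2_nth f \<alpha>) else 0)"
    unfolding cinner_ell2_def by (intro infsum_cong) (simp add: ell2_basis.rep_eq)
  also have "\<dots> = (\<Sum>\<^sub>\<infinity>\<beta>\<in>{\<alpha>}. cinner k (ell2_nth f \<alpha>))"
    by (intro infsum_cong_neutral) auto
  finally show ?thesis by simp
qed

lemma vacuum_tensor_eq: "vacuum_tensor k = ell2_basis [] k"
  by transfer auto

lemma creation_ell2_basis: "creation j (ell2_basis \<alpha> k) = ell2_basis (j # \<alpha>) k"
  by transfer (auto split: list.splits)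

lemma ell2_basis_add: "ell2_basis \<alpha> (k + l) = ell2_basis \<alpha> k + ell2_basis \<alpha> l"
  by transfer auto

lemma ell2_basis_scaleC: "ell2_basis \<alpha> (a *\<^sub>C k) = a *\<^sub>C ell2_basis \<alpha> k"
  by transfer auto

lemma ell2_basis_0 [simp]: "ell2_basis \<alpha> 0 = 0"
  by transfer auto

lemma creation_add: "creation j (f + g) = creation j f + creation j g"
  by transfer (auto split: list.splits)

lemma creation_scaleC: "creation j (a *\<^sub>C f) = a *\<^sub>C creation j f"
  by transfer (auto split: list.splits)

lemma creation_0 [simp]: "creation j 0 = 0"
  using creation_scaleC[of j 0 0] by simp

text \<open>A vector in the range of \<open>creation j\<close> is supported on words that begin with
  \<open>j\<close>. Equal letters reindex the sum; different ones have disjoint supports.\<close>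

lemma cinner_creation:
  "cinner (creation i f) (creation j g) = (if i = j then cinner f g else 0)"
proof -
  have "cinner (creation i f) (creation j g)
      = (\<Sum>\<^sub>\<infinity>\<alpha>\<in>range (Cons i). cinner (ell2_nth (creation i f) \<alpha>) (ell2_nth (creation j g) \<alpha>))"
    unfolding cinner_ell2_def
    by (intro infsum_cong_neutral) (auto simp: creation.rep_eq split: list.splits if_splits)
  also have "\<dots> = (\<Sum>\<^sub>\<infinity>\<alpha>. cinner (ell2_nth f \<alpha>) (if i = j then ell2_nth g \<alpha> else 0))"
    by (subst infsum_reindex) (auto simp: o_def creation.rep_eq)
  also have "\<dots> = (if i = j then cinner f g else 0)"
    by (simp add: cinner_ell2_def)
  finally show ?thesis .
qed

lemma cinner_vacuum_creation [simp]: "cinner (vacuum_tensor k) (creation j f) = 0"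
  by (simp add: vacuum_tensor_eq cinner_ell2_basis creation.rep_eq)

lemma cinner_creation_vacuum [simp]: "cinner (creation j f) (vacuum_tensor k) = 0"
  by (simp add: cinner_eq_0_commute[of _ "vacuum_tensor k"])

lemma ell2_nth_vacuum_creation:
  "ell2_nth (vacuum_tensor k + creation j f) \<alpha> =
    (case \<alpha> of [] \<Rightarrow> k | i # \<beta> \<Rightarrow> if i = j then ell2_nth f \<beta> else 0)"
  by (simp add: plus_ell2.rep_eq vacuum_tensor.rep_eq creation.rep_eq split: list.split)

lemma closed_csubspace_fock_tensor:
  assumes D: "closed_csubspace (D :: 'k::chilbert_space set)"
  shows "closed_csubspace (fock_tensor D :: ('d list, 'k) ell2 set)"
proof (rule closed_csubspaceI)
  have "bounded_linear (\<lambda>f :: ('d list, 'k) ell2. ell2_nth f \<alpha>)" for \<alpha>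
    by (rule bounded_linear_intro[where K = 1])
      (simp_all add: plus_ell2.rep_eq scaleR_ell2.rep_eq norm_ell2_nth_le)
  then have "closed ((\<lambda>f :: ('d list, 'k) ell2. ell2_nth f \<alpha>) -` D)" for \<alpha>
    by (rule closed_vimage[OF ccs_closed[OF D] linear_continuous_on])
  then have "closed (\<Inter>\<alpha>. (\<lambda>f :: ('d list, 'k) ell2. ell2_nth f \<alpha>) -` D)"
    by blast
  also have "(\<Inter>\<alpha>. (\<lambda>f :: ('d list, 'k) ell2. ell2_nth f \<alpha>) -` D) = fock_tensor D"
    by (auto simp: fock_tensor_def)
  finally show "closed (fock_tensor D :: ('d list, 'k) ell2 set)" .
qed (auto simp: fock_tensor_def plus_ell2.rep_eq scaleC_ell2.rep_eq zero_ell2.rep_eq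
    intro: ccs_0 ccs_add ccs_scaleC D)

lemma cinner_axis: "cinner (axis i h) (axis j k) = (if i = j then cinner h k else 0)"
proof -
  have "cinner (axis i h) (axis j k) = (\<Sum>l\<in>UNIV. if l = i then (if i = j then cinner h k else 0) else 0)"
    unfolding cinner_vec_def by (intro sum.cong) (auto simp: axis_def)
  then show ?thesis by simp
qed

lemma axis_add: "axis j (h + k) = axis j h + (axis j k :: 'a::monoid_add ^ 'n)"
  by (simp add: vec_eq_iff axis_def)

lemma axis_0 [simp]: "axis j 0 = 0"
  by (simp add: vec_eq_iff axis_def)

lemma axis_scaleC: "axis j (a *\<^sub>C h) = a *\<^sub>C axis j h"
  by (simp add: vec_eq_iff axis_def scaleC_vec_def)

lemma sum_axis: "(\<Sum>j\<in>UNIV. axis j (x $ j)) = (x :: 'a::comm_monoid_add ^ 'n)"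
  by (simp add: vec_eq_iff axis_def)

section \<open>The dilation of a single row contraction: isometry, orthogonal ranges,
  minimality\<close>

locale row_contraction_on =
  fixes H :: "'h::chilbert_space set" and S :: "'d::finite \<Rightarrow> 'h \<Rightarrow> 'h"
  assumes H: "closed_csubspace H" and S: "row_contraction H S"
begin

abbreviation V where "V \<equiv> dil H S"

lemma S_op: "bounded_op H H (S i)"
  using S by (simp add: row_contraction_def)

lemmas S_in = bop_in[OF S_op]

lemma S_0 [simp]: "S i 0 = 0"
  by (rule bop_0[OF S_op H])

lemma power_space: "closed_csubspace (power_space H :: ('h ^ 'd) set)"
  by (rule closed_csubspace_power_space[OF H])

lemma row: "contraction_op (power_space H) H (row_op S)"
  by (rule row_contraction_contraction_op[OF H S])

lemma defect_op: "bounded_op (power_space H) (power_space H) (row_defect H S)"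
  unfolding row_defect_def by (rule defect_bounded_op[OF row power_space])

lemma defect_0 [simp]: "row_defect H S 0 = 0"
  by (rule bop_0[OF defect_op power_space])

lemma row_defect_cinner:
  "x \<in> power_space H \<Longrightarrow> y \<in> power_space H \<Longrightarrow>
    cinner (row_defect H S x) (row_defect H S y) = cinner x y - cinner (row_op S x) (row_op S y)"
  unfolding row_defect_def by (rule defect_cinner[OF row power_space])

lemma row_defect_space: "closed_csubspace (row_defect_space H S)"
  unfolding row_defect_space_def by (rule closed_csubspace_defect_space[OF row power_space])

lemma row_defect_in: "x \<in> power_space H \<Longrightarrow> row_defect H S x \<in> row_defect_space H S"
  unfolding row_defect_space_def defect_space_def row_defect_def
  by (rule subsetD[OF closure_subset]) (rule imageI)

lemma axis_in: "h \<in> H \<Longrightarrow> axis j h \<in> power_space H"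
  using ccs_0[OF H] by (simp add: power_space_def axis_def)

lemma row_op_axis: "row_op S (axis j h) = S j h"
proof -
  have "row_op S (axis j h) = (\<Sum>i\<in>UNIV. if i = j then S j h else 0)"
    unfolding row_op_def by (intro sum.cong) (auto simp: axis_def)
  then show ?thesis by simp
qed

lemma dil_space: "closed_csubspace (dil_space H S)"
  unfolding dil_space_def
  by (intro closed_csubspace_Times closed_csubspace_fock_tensor H row_defect_space)

text \<open>By the Gram identity on axis vectors the defect term cancels the inner product of
  \<open>S i h\<close> and \<open>S j k\<close> and leaves that of the two axes, which vanishes for
  \<open>i \<noteq> j\<close>. The vacuum is orthogonal to the ranges of the creation
  operators.\<close>

lemma dil_cinner:
  assumes "x \<in> dil_space H S" "y \<in> dil_space H S"
  shows "cinner (V i x) (V j y) = (if i = j then cinner x y else 0)"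
proof -
  obtain h f k g where xy: "x = (h, f)" "y = (k, g)" "h \<in> H" "k \<in> H"
    using assms by (auto simp: dil_space_def)
  have "cinner (V i x) (V j y) = cinner (S i h) (S j k)
      + (cinner (row_defect H S (axis i h)) (row_defect H S (axis j k)) + (if i = j then cinner f g else 0))"
    by (simp add: xy dil_def cinner_prod_def cinner_add_left cinner_add_right cinner_creation)
      (simp add: vacuum_tensor_eq cinner_ell2_basis ell2_basis.rep_eq)
  then show ?thesis
    by (simp add: row_defect_cinner axis_in xy row_op_axis cinner_axis cinner_prod_def)
qed

lemma dil_in: "x \<in> dil_space H S \<Longrightarrow> V j x \<in> dil_space H S"
proof -
  assume "x \<in> dil_space H S"
  then obtain h f where x: "x = (h, f)" "h \<in> H" "\<And>\<alpha>. ell2_nth f \<alpha> \<in> row_defect_space H S"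
    by (auto simp: dil_space_def fock_tensor_def)
  then show "V j x \<in> dil_space H S"
    using ccs_0[OF row_defect_space] S_in[OF x(2), of j] row_defect_in[OF axis_in[OF x(2)], of j]
    by (simp add: dil_space_def dil_def fock_tensor_def ell2_nth_vacuum_creation split: list.split)
qed

lemma dil_op: "bounded_op (dil_space H S) (dil_space H S) (V j)"
proof (rule bounded_opI[where B = 1])
  show "norm (V j x) \<le> 1 * norm x" if "x \<in> dil_space H S" for x
    using norm_eq_of_cinner_eq[of "V j x" x] dil_cinner[OF that that, of j j] by simp
  show "V j (x + y) = V j x + V j y" if "x \<in> dil_space H S" "y \<in> dil_space H S" for x y
    using that
    by (auto simp: dil_space_def dil_def bop_add[OF S_op] axis_add bop_add[OF defect_op] axis_in
        vacuum_tensor_eq ell2_basis_add creation_add)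
  show "V j (a *\<^sub>C x) = a *\<^sub>C V j x" if "x \<in> dil_space H S" for a x
    using that
    by (auto simp: dil_space_def dil_def scaleC_prod_def bop_scaleC[OF S_op] axis_scaleC
        bop_scaleC[OF defect_op] axis_in vacuum_tensor_eq ell2_basis_scaleC creation_scaleC
        scaleC_add_right)
qed (rule dil_in)

lemma dil_0 [simp]: "V j 0 = 0"
  by (rule bop_0[OF dil_op dil_space])

lemma embed_in: "h \<in> H \<Longrightarrow> (h, 0) \<in> dil_space H S"
  using ccs_0[OF closed_csubspace_fock_tensor[OF row_defect_space]] by (simp add: dil_space_def)

lemma word_dil_in: "x \<in> dil_space H S \<Longrightarrow> word_op V \<alpha> x \<in> dil_space H S"
  by (rule word_op_in[OF dil_in])

text \<open>The Fock part never feeds back into \<open>H\<close>. Hence pairing with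
  \<open>(h, 0)\<close> sees only words in \<open>S\<close>.\<close>

lemma fst_word_dil: "fst (word_op V \<alpha> x) = word_op S \<alpha> (fst x)"
  by (induction \<alpha>) (auto simp: dil_def split: prod.split)

lemma word_dil_basis: "word_op V \<alpha> (0, ell2_basis [] k) = (0, ell2_basis \<alpha> k)"
proof (induction \<alpha>)
  case (Cons j \<alpha>)
  then show ?case
    by (simp add: dil_def creation_ell2_basis vacuum_tensor_eq)
qed simp

text \<open>The Fock part is reached because \<open>V\<^sub>\<alpha> V\<^sub>j h - V\<^sub>\<alpha> S\<^sub>j h = e\<^sub>\<alpha> \<otimes> D\<^sub>j h\<close>.\<close>

lemma dil_orth_eq_0:
  assumes x: "x \<in> dil_space H S" and orth: "\<And>\<alpha> h. h \<in> H \<Longrightarrow> cinner (word_op V \<alpha> (h, 0)) x = 0"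
  shows "x = 0"
proof -
  obtain g f where gf: "x = (g, f)" "g \<in> H" "\<And>\<alpha>. ell2_nth f \<alpha> \<in> row_defect_space H S"
    using x by (auto simp: dil_space_def fock_tensor_def)
  have "cinner (word_op V [] (g, 0)) x = 0"
    by (rule orth[OF \<open>g \<in> H\<close>])
  then have "g = 0"
    by (simp add: gf cinner_prod_def)
  have "ell2_nth f \<alpha> = 0" for \<alpha>
  proof -
    have "cinner (row_defect H S (axis j h)) (ell2_nth f \<alpha>) = 0" if h: "h \<in> H" for j h
    proof -
      let ?k = "row_defect H S (axis j h)"
      have k: "(0, ell2_basis [] ?k) \<in> dil_space H S"
        using ccs_0[OF H] row_defect_in[OF axis_in[OF h]] ccs_0[OF row_defect_space]
        by (simp add: dil_space_def fock_tensor_def ell2_basis.rep_eq)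
      have "V j (h, 0) = (S j h, 0) + (0, ell2_basis [] ?k)"
        by (simp add: dil_def vacuum_tensor_eq)
      then have "word_op V (\<alpha> @ [j]) (h, 0) = word_op V \<alpha> (S j h, 0) + (0, ell2_basis \<alpha> ?k)"
        using word_op_add[where S = V, OF dil_op embed_in[OF S_in[OF h]] k]
        by (simp only: word_op_append word_op.simps word_dil_basis o_apply id_apply)
      then show ?thesis
        using orth[OF h, of "\<alpha> @ [j]"] orth[OF S_in[OF h], of \<alpha> j]
        by (simp add: cinner_add_left gf) (simp add: cinner_prod_def cinner_ell2_basis)
    qed
    moreover have "row_defect H S y = (\<Sum>j\<in>UNIV. row_defect H S (axis j (y $ j)))"
      if y: "y \<in> power_space H" for y
    proof -
      have yj: "axis j (y $ j) \<in> power_space H" for j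
        using y by (intro axis_in) (simp add: power_space_def)
      have "row_defect H S (\<Sum>j\<in>J. axis j (y $ j)) = (\<Sum>j\<in>J. row_defect H S (axis j (y $ j)))" for J
        by (induction J rule: infinite_finite_induct)
          (simp_all add: bop_add[OF defect_op] yj ccs_sum[OF power_space])
      then show ?thesis using sum_axis[of y] by metis
    qed
    ultimately have *: "cinner (row_defect H S y) (ell2_nth f \<alpha>) = 0" if "y \<in> power_space H" for y
      using that by (simp add: cinner_sum_left power_space_def)
    \<comment> \<open>The coefficient lies in the closure of the very range to which it is
      orthogonal.\<close>
    have "cinner (ell2_nth f \<alpha>) (ell2_nth f \<alpha>) = 0"
    proof (rule orth_closure_span)
      show "cinner s (ell2_nth f \<alpha>) = 0" if "s \<in> row_defect H S ` power_space H" for s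
        using that * by blast
      show "ell2_nth f \<alpha> \<in> closure (cspan (row_defect H S ` power_space H))"
        using gf(3)[of \<alpha>] closure_mono[OF complex_vector.span_superset]
        unfolding row_defect_space_def defect_space_def row_defect_def by blast
    qed
    then show ?thesis by simp
  qed
  then have "f = 0" by transfer auto
  with \<open>g = 0\<close> show ?thesis by (simp add: gf zero_prod_def)
qed

text \<open>Minimality of the dilation. It makes the isometry obtained from matching Gram matrices
  reach the whole dilation space of \<open>C\<close>.\<close>

lemma generated_dil: "generated_space V (H \<times> {0}) = dil_space H S"
proof (rule eq_if_ominus_trivial[OF closed_csubspace_generated dil_space])
  show "generated_space V (H \<times> {0}) \<subseteq> dil_space H S"
    using embed_in by (intro generated_space_subset dil_space dil_in) auto
  show "x = 0" if "x \<in> dil_space H S" "\<And>m. m \<in> generated_space V (H \<times> {0}) \<Longrightarrow> cinner m x = 0" for x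
  proof (rule dil_orth_eq_0[OF that(1)])
    show "cinner (word_op V \<alpha> (h, 0)) x = 0" if "h \<in> H" for \<alpha> h
      using \<open>h \<in> H\<close> by (intro \<open>\<And>m. m \<in> _ \<Longrightarrow> cinner m x = 0\<close> word_op_in_generated) simp
  qed
qed

end


section \<open>The characteristic function\<close>

lemma cproj_cproj:
  assumes M: "closed_csubspace M" and N: "closed_csubspace N" and "M \<subseteq> N"
  shows "cproj M (cproj N x) = cproj M x"
proof (rule cproj_eqI[OF M cproj_in[OF M], symmetric])
  fix m assume m: "m \<in> M"
  have "m \<in> N" using m \<open>M \<subseteq> N\<close> by blast
  have "x - cproj M (cproj N x) = (x - cproj N x) + (cproj N x - cproj M (cproj N x))"
    by simp
  then show "cinner m (x - cproj M (cproj N x)) = 0"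
    using cproj_orth[OF M m, of "cproj N x"] cproj_orth[OF N \<open>m \<in> N\<close>, of x]
    by (simp only: cinner_add_right add_0)
qed

text \<open>The blocks \<open>B j\<close> and \<open>A j\<close> end in
  \<open>HE \<ominus> HC\<close>, so compression to \<open>HC\<close> leaves \<open>C j\<close>
  alone. One identity thereby replaces the existentially quantified blocks.\<close>

lemma lifting_compression:
  assumes L: "lifting HC C HE E" and x: "x \<in> HE"
  shows "cproj HC (E j x) = C j (cproj HC x)"
proof -
  have HC: "closed_csubspace HC" and HE: "closed_csubspace HE" and sub: "HC \<subseteq> HE"
    and C: "bounded_op HC HC (C j)"
    using L by (auto simp: lifting_def)
  obtain B A where B: "bounded_op HC (HE \<ominus> HC) (B j)" and A: "bounded_op (HE \<ominus> HC) (HE \<ominus> HC) (A j)"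
    and E: "\<And>c a. c \<in> HC \<Longrightarrow> a \<in> HE \<ominus> HC \<Longrightarrow> E j (c + a) = C j c + (B j c + A j a)"
    using L unfolding lifting_def by blast
  define c a where "c = cproj HC x" and "a = x - cproj HC x"
  have c: "c \<in> HC" and a: "a \<in> HE \<ominus> HC"
    using cproj_in[OF HC] cproj_ominus[OF HC sub HE x] by (auto simp: c_def a_def)
  have ba: "B j c + A j a \<in> HE \<ominus> HC"
    by (intro ccs_add closed_csubspace_ominus HE bop_in[OF B c] bop_in[OF A a])
  have "E j x = C j c + (B j c + A j a)"
    using E[OF c a] by (simp add: c_def a_def)
  then show ?thesis
    using ba bop_in[OF C c] unfolding c_def[symmetric]
    by (intro cproj_eqI[OF HC]) (auto simp: ominus_def)
qed

text \<open>The blocks are forced: \<open>E i - C i\<close> on \<open>HC\<close>, and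
  \<open>E i\<close> itself on \<open>HE \<ominus> HC\<close>, which the compression identity makes
  invariant.\<close>

lemma liftingI:
  assumes HC: "closed_csubspace HC" and HE: "closed_csubspace HE" and sub: "HC \<subseteq> HE"
    and C: "\<And>i. bounded_op HC HC (C i)" and E: "\<And>i. bounded_op HE HE (E i)"
    and comp: "\<And>i x. x \<in> HE \<Longrightarrow> cproj HC (E i x) = C i (cproj HC x)"
  shows "lifting HC C HE E"
proof -
  have B: "bounded_op HC (HE \<ominus> HC) (\<lambda>c. E i c - C i c)" for i
  proof -
    obtain b1 b2 where b: "\<And>c. c \<in> HE \<Longrightarrow> norm (E i c) \<le> b1 * norm c"
      "\<And>c. c \<in> HC \<Longrightarrow> norm (C i c) \<le> b2 * norm c"
      using bop_bound[OF E] bop_bound[OF C] by metis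
    show ?thesis
    proof (rule bounded_opI[where B = "b1 + b2"])
      fix c assume c: "c \<in> HC"
      then have cE: "c \<in> HE" using sub by blast
      show "E i c - C i c \<in> HE \<ominus> HC"
        using cproj_ominus[OF HC sub HE bop_in[OF E cE], of i] comp[OF cE] cproj_id[OF HC c] by simp
      show "norm (E i c - C i c) \<le> (b1 + b2) * norm c"
        using norm_triangle_ineq4[of "E i c" "C i c"] b(1)[OF cE] b(2)[OF c]
        by (simp add: distrib_right)
      fix a
      show "E i (a *\<^sub>C c) - C i (a *\<^sub>C c) = a *\<^sub>C (E i c - C i c)"
        by (simp add: bop_scaleC[OF E cE] bop_scaleC[OF C c] complex_vector.scale_right_diff_distrib)
    next
      fix c c' assume "c \<in> HC" "c' \<in> HC"
      moreover from this sub have "c \<in> HE" "c' \<in> HE" by auto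
      ultimately show "E i (c + c') - C i (c + c') = E i c - C i c + (E i c' - C i c')"
        by (simp add: bop_add[OF E] bop_add[OF C])
    qed
  qed
  have A: "bounded_op (HE \<ominus> HC) (HE \<ominus> HC) (E i)" for i
  proof -
    obtain b where b: "\<And>c. c \<in> HE \<Longrightarrow> norm (E i c) \<le> b * norm c"
      using bop_bound[OF E] by metis
    have aE: "a \<in> HE" if "a \<in> HE \<ominus> HC" for a
      using that by (simp add: ominus_def)
    show ?thesis
    proof (rule bounded_opI[where B = b])
      fix a assume a: "a \<in> HE \<ominus> HC"
      have "cproj HC a = 0"
        using a by (intro cproj_orth_eq_0[OF HC]) (simp add: ominus_def)
      then have "cproj HC (E i a) = 0"
        using comp[OF aE[OF a], of i] bop_0[OF C HC] by simp
      then show "E i a \<in> HE \<ominus> HC"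
        using cproj_ominus[OF HC sub HE bop_in[OF E aE[OF a]], of i] by simp
    qed (simp_all add: aE bop_add[OF E] bop_scaleC[OF E] b)
  qed
  have "E i (c + a) = C i c + ((E i c - C i c) + E i a)" if "c \<in> HC" "a \<in> HE \<ominus> HC" for i c a
  proof -
    have "c \<in> HE" "a \<in> HE" using that sub by (auto simp: ominus_def)
    then show ?thesis by (simp add: bop_add[OF E])
  qed
  with A B HC HE sub C show ?thesis
    unfolding lifting_def by (intro conjI exI[of _ "\<lambda>i c. E i c - C i c"] exI[of _ E]) auto
qed

text \<open>Liftings in compression form, which composes along
  \<open>HC \<subseteq> HE \<subseteq> HE'\<close>. It is available for \<open>Et\<close> before any
  blocks are exhibited.\<close>

locale contractive_lifting =
  base: row_contraction_on HC C + total: row_contraction_on HE E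
  for HC HE :: "'h::chilbert_space set" and C E :: "'d::finite \<Rightarrow> 'h \<Rightarrow> 'h" +
  assumes sub: "HC \<subseteq> HE"
    and comp: "x \<in> HE \<Longrightarrow> cproj HC (E j x) = C j (cproj HC x)"
begin

text \<open>The reducing subspace that carries the copy of the dilation of \<open>C\<close>.\<close>

definition N where "N = generated_space total.V (HC \<times> {0})"

lemma N: "closed_csubspace N"
  unfolding N_def by (rule closed_csubspace_generated)

lemma word_in_N: "h \<in> HC \<Longrightarrow> word_op total.V \<alpha> (h, 0) \<in> N"
  unfolding N_def by (rule word_op_in_generated) simp

lemma embed_in: "h \<in> HC \<Longrightarrow> (h, 0) \<in> dil_space HE E"
  using sub by (intro total.embed_in) auto

lemma N_subset: "N \<subseteq> dil_space HE E"
  unfolding N_def using embed_in by (intro generated_space_subset total.dil_space total.dil_in) auto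

lemma V_N: "x \<in> N \<Longrightarrow> total.V j x \<in> N"
  unfolding N_def
  using embed_in by (intro generated_space_invariant[OF total.dil_space total.dil_op]) auto

lemma cinner_compression:
  assumes "h \<in> HC" "x \<in> HE"
  shows "cinner h (E j x) = cinner h (C j (cproj HC x))"
  using cproj_orth[OF base.H assms(1), of "E j x"] comp[OF assms(2)]
  by (simp add: cinner_diff_right)

lemma cproj_word: "h \<in> HC \<Longrightarrow> cproj HC (word_op E \<alpha> h) = word_op C \<alpha> h"
proof (induction \<alpha>)
  case (Cons j \<alpha>)
  have "word_op E \<alpha> h \<in> HE"
    using Cons.prems sub by (intro word_op_in total.S_in) auto
  then show ?case using Cons by (simp add: comp)
qed (simp add: cproj_id[OF base.H])

text \<open>In both dilations a common first letter cancels and different first letters give zero.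
  Once one word is empty, only the compression of the other to \<open>HC\<close> is seen, and there
  a word in \<open>E\<close> becomes the word in \<open>C\<close>.\<close>

lemma gram:
  assumes h: "h \<in> HC" and k: "k \<in> HC"
  shows "cinner (word_op total.V \<alpha> (h, 0)) (word_op total.V \<beta> (k, 0))
    = cinner (word_op base.V \<alpha> (h, 0)) (word_op base.V \<beta> (k, 0))"
proof -
  have mixed: "cinner (h, 0) (word_op total.V \<beta> (k, 0)) = cinner (h, 0) (word_op base.V \<beta> (k, 0))"
    if "h \<in> HC" "k \<in> HC" for h k \<beta>
    using cproj_orth[OF base.H \<open>h \<in> HC\<close>, of "word_op E \<beta> k"] cproj_word[OF \<open>k \<in> HC\<close>, of \<beta>]
    by (simp add: cinner_prod_def total.fst_word_dil base.fst_word_dil cinner_diff_right)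
  show ?thesis
  proof (induction \<alpha> arbitrary: \<beta>)
    case Nil
    then show ?case using mixed[OF h k] by simp
  next
    case (Cons i \<alpha>)
    show ?case
    proof (cases \<beta>)
      case Nil
      then show ?thesis
        using mixed[OF k h, of "i # \<alpha>"] by (metis cinner_commute id_apply word_op.simps(1))
    next
      case (Cons j \<beta>')
      then show ?thesis
        using Cons.IH[of \<beta>'] h k
        by (simp add: total.dil_cinner base.dil_cinner total.word_dil_in base.word_dil_in embed_in
            base.embed_in)
    qed
  qed
qed

lemma moments_unique:
  assumes "p \<in> dil_space HC C" "q \<in> dil_space HC C"
    and "\<And>\<alpha> h. h \<in> HC \<Longrightarrow>
      cinner (word_op base.V \<alpha> (h, 0)) p = cinner (word_op base.V \<alpha> (h, 0)) q"
  shows "p = q"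
proof -
  have "p - q = 0"
    using assms by (intro base.dil_orth_eq_0 ccs_diff base.dil_space) (auto simp: cinner_diff_right)
  then show ?thesis by simp
qed

lemma generated_image:
  "generated_space V (M \<times> {0}) = closure (cspan ((\<lambda>(\<alpha>, h). word_op V \<alpha> (h, 0)) ` (UNIV \<times> M)))"
  unfolding generated_space_def
  by (rule arg_cong[where f = "\<lambda>S. closure (cspan S)"]) (force simp: image_iff)

lemma reduced_unitary_exists:
  "\<exists>U. unitary_op N (dil_space HC C) U \<and>
    (\<forall>\<alpha>. \<forall>h\<in>HC. U (word_op total.V \<alpha> (h, 0)) = word_op base.V \<alpha> (h, 0))"
proof -
  have "\<exists>U. unitary_op N (dil_space HC C) U \<and>
      (\<forall>i\<in>UNIV \<times> HC. U ((\<lambda>(\<alpha>, h). word_op total.V \<alpha> (h, 0)) i)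
        = (\<lambda>(\<alpha>, h). word_op base.V \<alpha> (h, 0)) i)"
    unfolding N_def base.generated_dil[symmetric] generated_image
    by (rule isometric_extension) (auto simp: gram)
  then show ?thesis by auto
qed

text \<open>\<open>N\<close> is reducing: if \<open>k\<close> is orthogonal to \<open>N\<close>, so
  is its image under the dilation. A nonempty word loses its first letter or gives zero. For the
  empty word, the first component of \<open>k\<close> is orthogonal to \<open>HC\<close>, so its
  image under \<open>E i\<close> has compression zero.\<close>

lemma cproj_N_dil:
  assumes x: "x \<in> dil_space HE E"
  shows "cproj N (total.V i x) = total.V i (cproj N x)"
proof (rule cproj_eqI[OF N V_N[OF cproj_in[OF N]]])
  define k where "k = x - cproj N x"
  have pN: "cproj N x \<in> dil_space HE E"
    using cproj_in[OF N] N_subset by blast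
  have k: "k \<in> dil_space HE E"
    unfolding k_def by (intro ccs_diff total.dil_space x pN)
  have k_orth: "cinner m k = 0" if "m \<in> N" for m
    unfolding k_def by (rule cproj_orth[OF N that])
  have kE: "fst k \<in> HE"
    using k by (auto simp: dil_space_def)
  have k0: "cproj HC (fst k) = 0"
  proof (rule cproj_orth_eq_0[OF base.H])
    fix h assume "h \<in> HC"
    from k_orth[OF word_in_N[OF this, of "[]"]] show "cinner h (fst k) = 0"
      by (simp add: cinner_prod_def)
  qed
  have gen: "cinner (word_op total.V \<alpha> (h, 0)) (total.V i k) = 0" if h: "h \<in> HC" for \<alpha> h
  proof (cases \<alpha>)
    case Nil
    then show ?thesis
      using cinner_compression[OF h kE, of i]
      by (simp add: k0 cinner_prod_def dil_def split_beta)
  next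
    case (Cons j \<beta>)
    then show ?thesis
      using k_orth[OF word_in_N[OF h, of \<beta>]] k
      by (simp add: total.dil_cinner total.word_dil_in embed_in h)
  qed
  fix m assume "m \<in> N"
  then have "cinner m (total.V i k) = 0"
    unfolding N_def generated_space_def by (rule orth_closure_span[rotated]) (auto simp: gen)
  then show "cinner m (total.V i x - total.V i (cproj N x)) = 0"
    by (simp add: k_def bop_diff[OF total.dil_op total.dil_space x pN])
qed

text \<open>The witness that gives the choice in \<open>char_fun\<close> its meaning:
  \<open>U\<close> moves \<open>N\<close> onto the dilation space of \<open>C\<close>, and the
  orthogonal complement stays in place.\<close>

lemma dil_unitary_exists: "\<exists>W. dil_unitary HC C HE E W"
proof -
  obtain U where U: "unitary_op N (dil_space HC C) U"
    and U_word: "\<And>\<alpha> h. h \<in> HC \<Longrightarrow> U (word_op total.V \<alpha> (h, 0)) = word_op base.V \<alpha> (h, 0)"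
    using reduced_unitary_exists by blast
  have U_op: "bounded_op N (dil_space HC C) U" and U_image: "U ` N = dil_space HC C"
    using U by (auto simp: unitary_op_def)
  note U_cinner = unitary_op_cinner[OF U]
  let ?P = "cproj N"
  let ?K = "dil_complement HC HE E"
  have K_def: "?K = dil_space HE E \<ominus> N"
    by (simp add: dil_complement_def N_def)
  define W where "W x = (U (?P x), x - ?P x)" for x
  note P_in = cproj_in[OF N]
  have P_K: "x - ?P x \<in> ?K" if "x \<in> dil_space HE E" for x
    unfolding K_def by (rule cproj_ominus[OF N N_subset total.dil_space that])
  have W_cinner: "cinner (W x) (W y) = cinner x y" if "x \<in> dil_space HE E" "y \<in> dil_space HE E" for x y
  proof -
    have "cinner x y = cinner (?P x + (x - ?P x)) (?P y + (y - ?P y))"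
      by simp
    also have "\<dots> = cinner (?P x) (?P y) + cinner (x - ?P x) (y - ?P y)"
      using cproj_orth[OF N P_in, of x y] cproj_orth[OF N P_in, of y x]
        cinner_eq_0_commute[of "?P y" "x - ?P x"]
      by (simp only: cinner_add_left cinner_add_right) simp
    finally show ?thesis
      by (simp add: W_def cinner_prod_def[where x = "(_, _)"] U_cinner P_in)
  qed
  have "bounded_op (dil_space HE E) (dil_space HC C \<times> ?K) W"
  proof (rule bounded_opI[where B = 1])
    show "W x \<in> dil_space HC C \<times> ?K" if "x \<in> dil_space HE E" for x
      using P_K[OF that] bop_in[OF U_op P_in] by (simp add: W_def)
    show "norm (W x) \<le> 1 * norm x" if "x \<in> dil_space HE E" for x
      using norm_eq_of_cinner_eq[OF W_cinner[OF that that]] by simp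
  qed (simp_all add: W_def cproj_add[OF N] cproj_scaleC[OF N] bop_add[OF U_op] bop_scaleC[OF U_op] P_in
      scaleC_prod_def[where x = "(U _, _)"] complex_vector.scale_right_diff_distrib)
  moreover have "W ` dil_space HE E = dil_space HC C \<times> ?K"
  proof
    show "W ` dil_space HE E \<subseteq> dil_space HC C \<times> ?K"
      using P_K bop_in[OF U_op P_in] by (auto simp: W_def)
    show "dil_space HC C \<times> ?K \<subseteq> W ` dil_space HE E"
    proof
      fix z assume z: "z \<in> dil_space HC C \<times> ?K"
      then have "fst z \<in> U ` N"
        unfolding U_image by auto
      then obtain n where n: "n \<in> N" "fst z = U n"
        by (rule imageE) blast
      have k: "snd z \<in> dil_space HE E" "\<And>m. m \<in> N \<Longrightarrow> cinner m (snd z) = 0"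
        using z by (auto simp: K_def ominus_def)
      have "?P (n + snd z) = n"
        using n k by (intro cproj_eqI[OF N]) auto
      then have "W (n + snd z) = z"
        using n(2) by (cases z) (simp add: W_def)
      moreover have "n + snd z \<in> dil_space HE E"
        using n k N_subset by (intro ccs_add total.dil_space) auto
      ultimately show "z \<in> W ` dil_space HE E" by (metis image_eqI)
    qed
  qed
  ultimately have unitary: "unitary_op (dil_space HE E) (dil_space HC C \<times> ?K) W"
    using W_cinner by (simp add: unitary_op_def)
  have W_HC: "W (h, 0) = ((h, 0), 0)" if h: "h \<in> HC" for h
    using cproj_id[OF N word_in_N[OF h, of "[]"]] U_word[OF h, of "[]"] by (simp add: W_def)
  have P_moment: "cinner (word_op base.V \<alpha> (h, 0)) (U (?P x)) = cinner (word_op total.V \<alpha> (h, 0)) x"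
    if h: "h \<in> HC" for \<alpha> h x
    using U_cinner[OF word_in_N[OF h] P_in, of \<alpha> x] cproj_orth[OF N word_in_N[OF h], of \<alpha> x]
    by (simp add: U_word[OF h] cinner_diff_right)
  have UP: "U (?P x) \<in> dil_space HC C" for x
    by (intro bop_in[OF U_op] P_in)
  \<comment> \<open>Both sides are compared by moments. A nonempty word reduces to a shorter one
    through \<open>dil_cinner\<close>; the empty word tests the component in \<open>HC\<close>,
    where the compression identity applies.\<close>
  have U_P_dil: "U (?P (total.V i x)) = base.V i (U (?P x))" if x: "x \<in> dil_space HE E" for i x
  proof (rule moments_unique)
    show "U (?P (total.V i x)) \<in> dil_space HC C"
      by (rule UP)
    show "base.V i (U (?P x)) \<in> dil_space HC C"
      by (intro base.dil_in UP)
    have xE: "fst x \<in> HE" using x by (auto simp: dil_space_def)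
    have fst_P: "fst (U (?P x)) = cproj HC (fst x)"
    proof (rule cproj_eqI[OF base.H, symmetric])
      show "fst (U (?P x)) \<in> HC"
        using UP[of x] by (auto simp: dil_space_def)
      show "cinner h (fst x - fst (U (?P x))) = 0" if "h \<in> HC" for h
        using P_moment[OF that, of "[]" x] by (simp add: cinner_prod_def cinner_diff_right)
    qed
    show "cinner (word_op base.V \<alpha> (h, 0)) (U (?P (total.V i x)))
        = cinner (word_op base.V \<alpha> (h, 0)) (base.V i (U (?P x)))" if h: "h \<in> HC" for \<alpha> h
    proof (cases \<alpha>)
      case Nil
      then show ?thesis
        using P_moment[OF h, of "[]" "total.V i x"] cinner_compression[OF h xE, of i] fst_P
        by (simp add: cinner_prod_def dil_def split_beta)
    next
      case (Cons j \<beta>)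
      then show ?thesis
        unfolding P_moment[OF h]
        using P_moment[OF h, of \<beta> x] UP[of x] x h
        by (simp add: total.dil_cinner base.dil_cinner total.word_dil_in base.word_dil_in
            embed_in base.embed_in)
    qed
  qed
  have "W (total.V i x) = map_prod (base.V i) (total.V i) (W x)" if x: "x \<in> dil_space HE E" for i x
  proof -
    have "?P x \<in> dil_space HE E" using P_in N_subset by blast
    then show ?thesis
      using U_P_dil[OF x, of i] by (simp add: W_def cproj_N_dil[OF x] bop_diff[OF total.dil_op total.dil_space x])
  qed
  with unitary W_HC show ?thesis
    unfolding dil_unitary_def by blast
qed

text \<open>The unitary sends each generator \<open>V\<^sub>\<alpha> h\<close> to its copy with
  second component zero. Preservation of inner products then involves only the first component of
  \<open>W (0, f)\<close>.\<close>

lemma char_fun_moments: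
  assumes f: "f \<in> fock_tensor (row_defect_space HE E)"
  shows "(0, char_fun HC C HE E f) \<in> dil_space HC C"
    and "h \<in> HC \<Longrightarrow> cinner (word_op base.V \<alpha> (h, 0)) (0, char_fun HC C HE E f)
      = cinner (word_op total.V \<alpha> (h, 0)) (0, f)"
proof -
  define W where "W = (SOME W. dil_unitary HC C HE E W)"
  have "dil_unitary HC C HE E W"
    unfolding W_def by (rule someI_ex[OF dil_unitary_exists])
  then have W: "unitary_op (dil_space HE E) (dil_space HC C \<times> dil_complement HC HE E) W"
    and W_HC: "\<And>h. h \<in> HC \<Longrightarrow> W (h, 0) = ((h, 0), 0)"
    and W_dil: "\<And>i x. x \<in> dil_space HE E \<Longrightarrow>
      W (total.V i x) = map_prod (base.V i) (total.V i) (W x)"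
    by (auto simp: dil_unitary_def)
  have x: "(0, f) \<in> dil_space HE E"
    using f ccs_0[OF total.H] by (simp add: dil_space_def)
  have W_word: "W (word_op total.V \<alpha> (h, 0)) = (word_op base.V \<alpha> (h, 0), 0)" if "h \<in> HC" for \<alpha> h
    by (induction \<alpha>)
      (simp_all add: W_HC W_dil that total.word_dil_in embed_in)
  have moment: "cinner (word_op base.V \<alpha> (h, 0)) (fst (W (0, f)))
      = cinner (word_op total.V \<alpha> (h, 0)) (0, f)" if h: "h \<in> HC" for \<alpha> h
    using unitary_op_cinner[OF W total.word_dil_in[OF embed_in[OF h]] x, of \<alpha>]
    by (simp add: W_word[OF h] cinner_prod_def)
  have "W (0, f) \<in> dil_space HC C \<times> dil_complement HC HE E"
    using W x by (auto simp only: unitary_op_def)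
  then have fstW: "fst (W (0, f)) \<in> dil_space HC C"
    by auto
  then have c: "fst (fst (W (0, f))) \<in> HC"
    by (auto simp: dil_space_def)
  \<comment> \<open>The component in \<open>HC\<close> is tested against itself at the empty word,
    where the right-hand side pairs \<open>(h, 0)\<close> with \<open>(0, f)\<close>.\<close>
  from moment[OF c, of "[]"] have "fst (fst (W (0, f))) = 0"
    by (simp add: cinner_prod_def)
  then have eq: "fst (W (0, f)) = (0, char_fun HC C HE E f)"
    by (simp add: char_fun_def W_def prod_eq_iff)
  show "(0, char_fun HC C HE E f) \<in> dil_space HC C"
    using fstW by (simp add: eq)
  show "cinner (word_op base.V \<alpha> (h, 0)) (0, char_fun HC C HE E f)
      = cinner (word_op total.V \<alpha> (h, 0)) (0, f)" if "h \<in> HC"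
    using moment[OF that] by (simp add: eq)
qed

end

lemma contractive_lifting_of_minimal:
  assumes "row_contraction HC C" "minimal_contractive_lifting HC C HE E"
  shows "contractive_lifting HC HE C E"
proof -
  have L: "lifting HC C HE E" and E: "row_contraction HE E"
    using assms(2) by (auto simp: minimal_contractive_lifting_def)
  show ?thesis
    using L E assms(1) lifting_compression[OF L]
    by unfold_locales (auto simp: lifting_def)
qed


section \<open>Restriction to the generated subspace\<close>

lemma ell2_eqI: "(\<And>i. ell2_nth f i = ell2_nth g i) \<Longrightarrow> f = g"
  by transfer auto

text \<open>Contractivity of \<open>T\<close> on \<open>D\<close> keeps the family square summable,
  so that \<open>Abs_ell2\<close> can be undone.\<close>

lemma ell2_nth_amplification:
  assumes "f \<in> fock_tensor D" "\<And>k. k \<in> D \<Longrightarrow> norm (T k) \<le> norm k"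
  shows "ell2_nth (amplification T f) \<alpha> = T (ell2_nth f \<alpha>)"
proof -
  have "square_summable (\<lambda>\<alpha>. T (ell2_nth f \<alpha>))"
    using assms by (intro square_summable_bound[OF square_summable_ell2_nth[of f], of _ 1])
      (auto simp: fock_tensor_def)
  then show ?thesis
    by (simp add: amplification_def Abs_ell2_inverse)
qed

lemma cinner_amplification:
  assumes "f \<in> fock_tensor D" "g \<in> fock_tensor D"
    and "\<And>k l. k \<in> D \<Longrightarrow> l \<in> D \<Longrightarrow> cinner (T k) (T l) = cinner k l"
  shows "cinner (amplification T f) (amplification T g) = cinner f g"
proof -
  have "norm (T k) \<le> norm k" if "k \<in> D" for k
    using norm_eq_of_cinner_eq[OF assms(3)[OF that that]] by simp
  then show ?thesis
    using assms unfolding cinner_ell2_def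
    by (intro infsum_cong) (auto simp: ell2_nth_amplification fock_tensor_def)
qed

text \<open>\<open>T\<close> stands for \<open>\<sigma>\<^sup>-\<^sup>1\<close> on the first
  summand; the assumptions on it are isometry and the transport of one defect operator to the
  other.\<close>

locale invariant_restriction =
  full: row_contraction_on HE' E' + restricted: row_contraction_on HE E
  for HE' HE :: "'h::chilbert_space set" and E' E :: "'d::finite \<Rightarrow> 'h \<Rightarrow> 'h" +
  fixes T :: "'h ^ 'd \<Rightarrow> 'h ^ 'd"
  assumes HE_subset: "HE \<subseteq> HE'"
    and restr: "\<And>x i. x \<in> HE \<Longrightarrow> E i x = E' i x"
    and T_in: "\<And>k. k \<in> row_defect_space HE E \<Longrightarrow> T k \<in> row_defect_space HE' E'"
    and T_cinner: "\<And>k l. k \<in> row_defect_space HE E \<Longrightarrow> l \<in> row_defect_space HE E \<Longrightarrow>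
      cinner (T k) (T l) = cinner k l"
    and T_defect: "\<And>x. x \<in> power_space HE \<Longrightarrow> T (row_defect HE E x) = row_defect HE' E' x"
begin

definition J where "J x = (fst x, amplification T (snd x))" for x :: "('h, 'd) dil"

lemma T_norm: "k \<in> row_defect_space HE E \<Longrightarrow> norm (T k) \<le> norm k"
  using norm_eq_of_cinner_eq[OF T_cinner] by simp

lemma T_0: "T 0 = 0"
  using T_norm[OF ccs_0[OF restricted.row_defect_space]] by simp

lemmas nth_amplification = ell2_nth_amplification[where D = "row_defect_space HE E" and T = T, OF _ T_norm]

lemma amplification_in:
  "f \<in> fock_tensor (row_defect_space HE E) \<Longrightarrow> amplification T f \<in> fock_tensor (row_defect_space HE' E')"
  by (simp add: fock_tensor_def nth_amplification[unfolded fock_tensor_def] T_in)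

text \<open>Coefficients are compared word by word: the empty word is \<open>T_defect\<close>, and
  the zeros produced by \<open>creation\<close> survive because \<open>T 0 = 0\<close>.\<close>

lemma J_dil:
  assumes x: "x \<in> dil_space HE E"
  shows "J (restricted.V i x) = full.V i (J x)"
proof -
  obtain h f where hf: "x = (h, f)" "h \<in> HE" "f \<in> fock_tensor (row_defect_space HE E)"
    using x by (auto simp: dil_space_def)
  have in_fock: "vacuum_tensor (row_defect HE E (axis i h)) + creation i f
      \<in> fock_tensor (row_defect_space HE E)"
    using restricted.dil_in[OF x, of i] by (simp add: hf dil_def dil_space_def)
  have "amplification T (vacuum_tensor (row_defect HE E (axis i h)) + creation i f)
      = vacuum_tensor (row_defect HE' E' (axis i h)) + creation i (amplification T f)"
    by (rule ell2_eqI)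
      (simp add: nth_amplification[OF in_fock] nth_amplification[OF hf(3)] ell2_nth_vacuum_creation
        T_0 T_defect restricted.axis_in hf(2) split: list.split)
  then show ?thesis
    by (simp add: J_def dil_def hf restr)
qed

lemma word_dil_restriction:
  assumes h: "h \<in> HE"
  shows "word_op full.V \<alpha> (h, 0) = J (word_op restricted.V \<alpha> (h, 0))"
proof (induction \<alpha>)
  case Nil
  have "0 \<in> fock_tensor (row_defect_space HE E)"
    by (intro ccs_0 closed_csubspace_fock_tensor restricted.row_defect_space)
  from nth_amplification[OF this] have "amplification T 0 = (0 :: ('d list, 'h ^ 'd) ell2)"
    by (intro ell2_eqI) (simp add: zero_ell2.rep_eq T_0)
  then show ?case by (simp add: J_def)
next
  case (Cons i \<alpha>)
  then show ?case
    by (simp add: J_dil restricted.word_dil_in restricted.embed_in h)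
qed

lemma moment_restriction:
  assumes h: "h \<in> HE" and f: "f \<in> fock_tensor (row_defect_space HE E)"
  shows "cinner (word_op full.V \<alpha> (h, 0)) (0, amplification T f)
    = cinner (word_op restricted.V \<alpha> (h, 0)) (0, f)"
proof -
  have "snd (word_op restricted.V \<alpha> (h, 0)) \<in> fock_tensor (row_defect_space HE E)"
    using restricted.word_dil_in[OF restricted.embed_in[OF h], of \<alpha>] by (auto simp: dil_space_def)
  then show ?thesis
    using cinner_amplification[OF _ f T_cinner]
    by (simp add: word_dil_restriction[OF h] J_def cinner_prod_def)
qed

end

lemma word_op_restriction:
  assumes "\<And>i y. y \<in> H \<Longrightarrow> S i y = S' i y" "\<And>i y. y \<in> H \<Longrightarrow> S i y \<in> H" "x \<in> H"
  shows "word_op S \<alpha> x = word_op S' \<alpha> x"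
proof -
  have "word_op S \<alpha> x = word_op S' \<alpha> x \<and> word_op S \<alpha> x \<in> H"
    using assms by (induction \<alpha>) auto
  then show ?thesis ..
qed

text \<open>The norm inequality restricts at once, whereas passing to an invariant subspace
  compresses the adjoints.\<close>

lemma row_contraction_restriction:
  fixes S :: "'d::finite \<Rightarrow> 'h::chilbert_space \<Rightarrow> 'h"
  assumes H: "closed_csubspace H" and S: "row_contraction H S"
    and M: "closed_csubspace M" and "M \<subseteq> H" and inv: "\<And>i x. x \<in> M \<Longrightarrow> S i x \<in> M"
    and R: "\<And>i x. x \<in> M \<Longrightarrow> R i x = S i x"
  shows "row_contraction M R"
  unfolding row_contraction_iff[OF M]
proof (intro conjI allI ballI)
  have S': "bounded_op H H (S i)" for i
    using S by (simp add: row_contraction_def)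
  show "bounded_op M M (R i)" for i
  proof -
    obtain B where B: "\<And>x. x \<in> H \<Longrightarrow> norm (S i x) \<le> B * norm x"
      using bop_bound[OF S'] by blast
    have MH: "x \<in> H" if "x \<in> M" for x using that \<open>M \<subseteq> H\<close> by blast
    show ?thesis
      by (rule bounded_opI[where B = B])
        (simp_all add: R inv ccs_add[OF M] ccs_scaleC[OF M] bop_add[OF S'] bop_scaleC[OF S'] B MH)
  qed
  fix x :: "'h ^ 'd" assume x: "x \<in> power_space M"
  then have "row_op R x = row_op S x" "x \<in> power_space H"
    using \<open>M \<subseteq> H\<close> R by (auto simp: row_op_def power_space_def intro!: sum.cong)
  then show "norm (row_op R x) \<le> norm x"
    using S by (simp add: row_contraction_iff[OF H])
qed

theorem theorem4p1:
  fixes HC HE HE' HEt HAt :: "'h::chilbert_space set"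
    and C E E' Et Xt At :: "'d::finite \<Rightarrow> 'h \<Rightarrow> 'h"
  assumes "CARD('d) \<ge> 2"
    and "row_contraction HC C"
    and "minimal_contractive_lifting HC C HE E"
    and "minimal_contractive_lifting HE E HE' E'"
    and "HEt = generated_space E' HC"
    and "Et = (\<lambda>i. restrict (E' i) HEt)"
    and "HAt = HE' \<ominus> HEt"
    and "Xt = (\<lambda>i. restrict (\<lambda>x. cproj HEt (E' i x)) HAt)"
    and "At = (\<lambda>i. restrict (\<lambda>x. cproj HAt (E' i x)) HAt)"
  shows "minimal_contractive_lifting HC C HEt Et \<and>
    (\<forall>\<gamma> \<sigma>.
      contraction_op (row_defect_space HAt At) (star_defect_space HEt Et) \<gamma> \<and>
      (\<forall>y\<in>power_space HAt. row_op Xt y = star_defect HEt Et (\<gamma> (row_defect HAt At y))) \<and>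
      unitary_op (row_defect_space HE' E')
        (row_defect_space HEt Et \<times>
          defect_space (row_defect_space HAt At) (star_defect_space HEt Et) \<gamma>) \<sigma> \<and>
      (\<forall>x\<in>power_space HEt. \<forall>y\<in>power_space HAt.
        \<sigma> (row_defect HE' E' (x + y)) =
          (row_defect HEt Et x
             - adj (power_space HEt) HEt (row_op Et) (\<gamma> (row_defect HAt At y)),
           defect (row_defect_space HAt At) (star_defect_space HEt Et) \<gamma> (row_defect HAt At y)))
      \<longrightarrow>
      (\<forall>f\<in>fock_tensor (row_defect_space HEt Et).
        char_fun HC C HEt Et f =
          char_fun HC C HE E (char_fun HE E HE' E'
            (amplification (\<lambda>k. inv_into (row_defect_space HE' E') \<sigma> (k, 0)) f))))"
proof -
  interpret CE: contractive_lifting HC HE C E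
    by (rule contractive_lifting_of_minimal[OF assms(2,3)])
  interpret EE': contractive_lifting HE HE' E E'
    using assms(3,4)
    by (intro contractive_lifting_of_minimal) (auto simp: minimal_contractive_lifting_def)
  have HC_HE': "HC \<subseteq> HE'"
    using CE.sub EE'.sub by blast
  have HEt: "closed_csubspace HEt"
    unfolding assms(5) by (rule closed_csubspace_generated)
  have HEt_HE': "HEt \<subseteq> HE'"
    unfolding assms(5)
    by (rule generated_space_subset[OF EE'.total.H EE'.total.S_in HC_HE'])
  have HC_HEt: "HC \<subseteq> HEt"
    unfolding assms(5) using word_op_in_generated[of _ HC E' "[]"] by auto
  have E'_HEt: "E' i x \<in> HEt" if "x \<in> HEt" for i x
    using that unfolding assms(5)
    by (rule generated_space_invariant[OF EE'.total.H EE'.total.S_op HC_HE'])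
  have Et: "Et i x = E' i x" if "x \<in> HEt" for i x
    using that by (simp add: assms(6))
  have Et_row: "row_contraction HEt Et"
    by (rule row_contraction_restriction[OF EE'.total.H EE'.total.S HEt HEt_HE' E'_HEt Et])
  \<comment> \<open>Compressing first to \<open>HE\<close> and then to \<open>HC\<close> lets the
    lifting identities of \<open>E'\<close> and of \<open>E\<close> act in turn.\<close>
  have comp: "cproj HC (Et i x) = C i (cproj HC x)" if x: "x \<in> HEt" for i x
  proof -
    have "x \<in> HE'" using x HEt_HE' by blast
    have "cproj HC (Et i x) = cproj HC (cproj HE (E' i x))"
      by (simp add: Et[OF x] cproj_cproj[OF CE.base.H CE.total.H CE.sub])
    also have "\<dots> = C i (cproj HC (cproj HE x))"
      using EE'.comp[OF \<open>x \<in> HE'\<close>] CE.comp[OF cproj_in[OF CE.total.H]] by simp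
    finally show ?thesis
      by (simp add: cproj_cproj[OF CE.base.H CE.total.H CE.sub])
  qed
  interpret CEt: contractive_lifting HC HEt C Et
    by unfold_locales (fact HEt Et_row HC_HEt comp)+
  have "lifting HC C HEt Et"
    by (rule liftingI[OF CE.base.H HEt HC_HEt CE.base.S_op CEt.total.S_op comp])
  moreover have "HEt = generated_space Et HC"
  proof -
    have "word_op E' \<alpha> x = word_op Et \<alpha> x" if "x \<in> HC" for \<alpha> x
      using HC_HEt that by (intro word_op_restriction[of HEt, symmetric]) (auto simp: Et E'_HEt)
    then have "{word_op E' \<alpha> x |\<alpha> x. x \<in> HC} = {word_op Et \<alpha> x |\<alpha> x. x \<in> HC}"
      by metis
    then show ?thesis
      by (simp add: assms(5) generated_space_def)
  qed
  ultimately have minimal: "minimal_contractive_lifting HC C HEt Et"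
    using Et_row by (simp add: minimal_contractive_lifting_def)
  have "char_fun HC C HEt Et f =
      char_fun HC C HE E (char_fun HE E HE' E'
        (amplification (\<lambda>k. inv_into (row_defect_space HE' E') \<sigma> (k, 0)) f))"
    if \<sigma>: "unitary_op (row_defect_space HE' E')
        (row_defect_space HEt Et \<times>
          defect_space (row_defect_space HAt At) (star_defect_space HEt Et) \<gamma>) \<sigma>"
      and \<sigma>_eq: "\<forall>x\<in>power_space HEt. \<forall>y\<in>power_space HAt.
        \<sigma> (row_defect HE' E' (x + y)) =
          (row_defect HEt Et x
             - adj (power_space HEt) HEt (row_op Et) (\<gamma> (row_defect HAt At y)),
           defect (row_defect_space HAt At) (star_defect_space HEt Et) \<gamma> (row_defect HAt At y))"
      and f: "f \<in> fock_tensor (row_defect_space HEt Et)"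
    for \<gamma> \<sigma> f
  proof -
    let ?D' = "row_defect_space HE' E'" and ?Dt = "row_defect_space HEt Et"
      and ?D\<gamma> = "defect_space (row_defect_space HAt At) (star_defect_space HEt Et) \<gamma>"
    have \<sigma>_op: "bounded_op ?D' (?Dt \<times> ?D\<gamma>) \<sigma>" and \<sigma>_image: "\<sigma> ` ?D' = ?Dt \<times> ?D\<gamma>"
      using \<sigma> by (auto simp: unitary_op_def)
    note \<sigma>_cinner = unitary_op_cinner[OF \<sigma>]
    have HAt: "closed_csubspace HAt"
      unfolding assms(7) by (rule closed_csubspace_ominus[OF EE'.total.H])
    have 0: "(0 :: 'h ^ 'd) \<in> power_space HAt" "(0 :: 'h ^ 'd) \<in> power_space HEt"
      by (intro ccs_0 closed_csubspace_power_space HAt HEt)+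
    \<comment> \<open>Linearity of \<open>\<sigma>\<close> at \<open>0\<close> makes the terms with \<open>\<gamma>\<close> vanish at \<open>y = 0\<close>.\<close>
    have "\<sigma> (row_defect HE' E' 0) = 0"
      using bop_0[OF \<sigma>_op EE'.total.row_defect_space] by simp
    then have zero: "adj (power_space HEt) HEt (row_op Et) (\<gamma> (row_defect HAt At 0)) = 0"
      "defect (row_defect_space HAt At) (star_defect_space HEt Et) \<gamma> (row_defect HAt At 0) = 0"
      using \<sigma>_eq[rule_format, OF 0(2,1)] by (simp_all add: zero_prod_def)
    have \<sigma>_defect: "\<sigma> (row_defect HE' E' x) = (row_defect HEt Et x, 0)" if "x \<in> power_space HEt" for x
      using \<sigma>_eq[rule_format, OF that 0(1)] zero by simp
    \<comment> \<open>Membership of 0 in \<open>?D\<gamma>\<close> is read off from the equation for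
      \<open>\<sigma>\<close>: the defect operator of \<open>\<gamma>\<close> sends this vector to
      0. It puts every \<open>(k, 0)\<close> into the range of \<open>\<sigma>\<close>.\<close>
    have "row_defect HAt At 0 \<in> row_defect_space HAt At"
      unfolding row_defect_def row_defect_space_def defect_space_def
      by (rule subsetD[OF closure_subset imageI[OF 0(1)]])
    then have "0 \<in> ?D\<gamma>"
      unfolding defect_space_def using zero(2) by (intro subsetD[OF closure_subset]) (metis imageI)
    define T where "T k = inv_into ?D' \<sigma> (k, 0)" for k
    have in_image: "(k, 0) \<in> \<sigma> ` ?D'" if "k \<in> ?Dt" for k
      using that \<open>0 \<in> ?D\<gamma>\<close> by (simp add: \<sigma>_image)
    have T_in: "T k \<in> ?D'" and \<sigma>_T: "\<sigma> (T k) = (k, 0)" if "k \<in> ?Dt" for k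
      unfolding T_def by (rule inv_into_into[OF in_image[OF that]], rule f_inv_into_f[OF in_image[OF that]])
    have T_cinner: "cinner (T k) (T l) = cinner k l" if "k \<in> ?Dt" "l \<in> ?Dt" for k l
      using \<sigma>_cinner[OF T_in T_in, OF that] \<sigma>_T that by (simp add: cinner_prod_def)
    \<comment> \<open>Injectivity ensures that \<open>inv_into\<close> applied to
      \<open>(row_defect HEt Et x, 0)\<close> returns \<open>row_defect HE' E' x\<close> and no
      other preimage.\<close>
    have "inj_on \<sigma> ?D'"
    proof (rule inj_onI)
      fix u v assume uv: "u \<in> ?D'" "v \<in> ?D'" "\<sigma> u = \<sigma> v"
      have "u - v \<in> ?D'"
        by (intro ccs_diff EE'.total.row_defect_space uv)
      from norm_eq_of_cinner_eq[OF \<sigma>_cinner[OF this this]] uv show "u = v"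
        by (simp add: bop_diff[OF \<sigma>_op EE'.total.row_defect_space])
    qed
    then have T_defect: "T (row_defect HEt Et x) = row_defect HE' E' x" if x: "x \<in> power_space HEt" for x
    proof -
      have "x \<in> power_space HE'"
        using x HEt_HE' by (auto simp: power_space_def)
      then show ?thesis
        unfolding T_def using \<open>inj_on \<sigma> ?D'\<close> \<sigma>_defect[OF x]
        by (intro inv_into_f_eq EE'.total.row_defect_in)
    qed
    interpret R: invariant_restriction HE' HEt E' Et T
      by unfold_locales (fact HEt_HE' Et T_in T_cinner T_defect)+
    let ?g = "amplification T f"
    have g: "?g \<in> fock_tensor ?D'"
      by (rule R.amplification_in[OF f])
    note M' = EE'.char_fun_moments[OF g]
    have M'_in: "char_fun HE E HE' E' ?g \<in> fock_tensor (row_defect_space HE E)"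
      using M'(1) by (simp add: dil_space_def)
    note M = CE.char_fun_moments[OF M'_in]
    note Mt = CEt.char_fun_moments[OF f]
    \<comment> \<open>Pairing with 0 places both sides in the dilation space of \<open>C\<close>,
      where moments determine a vector.\<close>
    have "(0 :: 'h, char_fun HC C HEt Et f) = (0, char_fun HC C HE E (char_fun HE E HE' E' ?g))"
    proof (rule CE.moments_unique[OF Mt(1) M(1)])
      \<comment> \<open>The same \<open>h\<close> serves for all liftings. The right side unwinds to
        a moment of the amplified \<open>f\<close> for \<open>E'\<close>, the left side to a moment
        of \<open>f\<close> for \<open>Et\<close>, and these agree by
        \<open>R.moment_restriction\<close>.\<close>
      fix \<alpha> h assume h: "h \<in> HC"
      then have "h \<in> HE" "h \<in> HEt"
        using CE.sub HC_HEt by auto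
      then show "cinner (word_op CE.base.V \<alpha> (h, 0)) (0, char_fun HC C HEt Et f)
          = cinner (word_op CE.base.V \<alpha> (h, 0)) (0, char_fun HC C HE E (char_fun HE E HE' E' ?g))"
        by (simp only: Mt(2)[OF h] M(2)[OF h] M'(2) R.moment_restriction[OF _ f])
    qed
    then show ?thesis
      by (simp add: T_def[abs_def])
  qed
  with minimal show ?thesis by blast
qed

end
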